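(* Let $s$ be the (scalar) seed parameter, $\sigma R(B)=R(B+2i)$, and let $S_s\subset\mathbb C[B]$ be the multiplicative set generated by $\sigma^kd,\ \sigma^k\ell_+,\ \sigma^k\ell_-$ ($k\in\mathbb Z$), where $d(B)=B-i$, $\ell_+(B)=s-2iB$, $\ell_-(B)=s+2iB$; put $\mathcal A_s^{\min}=S_s^{-1}\mathbb C[B]$. Then $\mathcal A_s^{\min}$ is sufficient for (i.e. all coefficients lie in it of) the two conjugate chargewise seed differentials $\mathbb Q_c^\pm$, their canonical contracting homotopies $\mathbb h_c^\pm$, and the two triangular connection gauges (built from $\mathbb N_c^\pm=-\mathbb h_c^\pm\mathbb M_c^\pm$), for every $c\in\mathbb Z$. It is minimal in the following shift-stable sense: if a $\sigma$-stable multiplicative set makes the canonical four-slot complexes of both polarizations contractible on every charge, then its saturation contains $S_s$. For finite fermionic support ($n$ pairs) the minimal localization is the tensor product of the corresponding one-pair localizations, and no mixed Cartan denominator is needed. At special $s$ some of the three orbit families may coalesce.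
   Context: One fermionic pair: Grassmann generators $\vartheta,\bar\vartheta$ (odd), Weyl generators $a,b$ (even), $ab-ba=-2i$, $B=ba-i$ (so $bR(B)=R(B+2i)b$, $aR(B)=R(B-2i)a$). $x_j=a^j$ ($j\ge0$), $x_j=b^{-j}$ ($j<0$); $\beta_j(B)=B+(2j-1)i$ for $j\ge1$ and $1$ for $j\le0$; $\alpha_j(B)=1$ for $j\ge0$ and $B+(2j+1)i$ for $j\le-1$. The charge-$c$ module ($c\in\mathbb Z$) is the free right module over the Cartan coefficient ring (a localization of $\mathbb C[B]$) on $e_{0,c}=x_c$, $e_{\vartheta,c}=\vartheta x_{c+1}$, $e_{\bar\vartheta,c}=\bar\vartheta x_{c-1}$, $e_{2,c}=\vartheta\bar\vartheta x_c$. $\Phi_s(B)=\frac{4-s+2iB}{B-i}$, $\Psi_s(B)=\frac{-s-2iB}{B-i}$, $\sigma_c^+(B)=\beta_{c+1}(B)\Phi_s(B+2i(c+1))$, $\sigma_c^-(B)=\alpha_{c-1}(B)\Psi_s(B+2ic)$, $\pi_c^\pm=-\frac14\sigma_c^\pm$. Canonical four-slot complexes: right-linear maps (zero on unlisted basis vectors) $\mathbb Q_c^+:e_{\vartheta,c}\mapsto e_{0,c}\pi_c^+,\ e_{2,c}\mapsto\frac1{2i}e_{\bar\vartheta,c}\beta_c$ and its conjugate $\mathbb Q_c^-:e_{\bar\vartheta,c}\mapsto e_{0,c}\pi_c^-,\ e_{2,c}\mapsto\frac1{2i}e_{\vartheta,c}\alpha_c$. Canonical homotopies (inverse arrows): $\mathbb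 h_c^+:e_{0,c}\mapsto e_{\vartheta,c}(\pi_c^+)^{-1},\ e_{\bar\vartheta,c}\mapsto2i\,e_{2,c}\beta_c^{-1}$; $\mathbb h_c^-:e_{0,c}\mapsto e_{\bar\vartheta,c}(\pi_c^-)^{-1},\ e_{\vartheta,c}\mapsto2i\,e_{2,c}\alpha_c^{-1}$. Contractible means there is an odd right-linear map $h$ over the localized ring with $\{\mathbb Q_c^\pm,h\}=I$. Triangular connection gauges: with $c_r=\frac{1-q^{2r}}{2(1-q)}$, $[2m]_q=\frac{1-q^{2m}}{1-q}$, $\delta_m(q)=\frac{2m-[2m]_q}4$, $\kappa_c^+=-\frac14\sigma_c^+\alpha_c$, $K_c=\frac1{2i}\alpha_{c-1}\beta_c$, and $\mathsf P^+$ the projector onto the span of $e_{\bar\vartheta,c},e_{2,c}$ (killing $e_{0,c},e_{\vartheta,c}$), the one-pair defect on bosonic elements of antiholomorphic Euler degree $r$ is $\mathbb M_c^+=\delta_m(q)I+\mathsf P^+\big(\kappa_c^+-1-\frac{c_{r+1}}{r+1}K_c\big)$, and $\mathbb M_c^-$ is its conjugate under the order-preserving antilinear involution $\vartheta\leftrightarrow\bar\vartheta$, $a\leftrightarrow b$ (which sends $c\to-c$). The triangular gauges are exponentials $\exp(\sum_i\mathfrak n_i^\pm\widehat\otimes\mathbb N_i^\pm)$ with $\mathbb N_i^\pm$ copies of $\mathbb N^\pm=-\mathbb h^\pm\mathbb M^\pm$ and $\mathfrak n_i^\pm$ bosonic operators not involving $B$. For $n$ pairs the charge modules are graded tensor products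 of one-pair charge modules, with $\mathbb Q^\pm=\sum_j\widehat{\mathbb Q}_j^\pm$, $\mathbb h^\pm=\frac1n\sum_j\widehat{\mathbb h}_j^\pm$. *)

theory Defs
  imports
    "HOL-Analysis.Finite_Cartesian_Product"
    "HOL-Computational_Algebra.Computational_Algebra"
    "HOL-Library.Poly_Mapping"
begin

subsection \<open>Multiplicative sets, saturations, localizations\<close>

definition mult_set :: "'a::comm_ring_1 set \<Rightarrow> bool" where
  "mult_set T \<longleftrightarrow> 1 \<in> T \<and> (\<forall>x\<in>T. \<forall>y\<in>T. x * y \<in> T)"

definition saturation :: "'a::comm_ring_1 set \<Rightarrow> 'a set" where
  "saturation T = {p. \<exists>u. p * u \<in> T}"

text \<open>The localization \<open>T\<^sup>-\<^sup>1 R\<close> as a subring of the fraction field of \<open>R\<close>. This is meaningful only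
  for \<open>0 \<notin> T\<close>; a multiplicative set containing \<open>0\<close> has all of \<open>R\<close> as its saturation.\<close>

definition loc :: "'a::idom set \<Rightarrow> 'a fract set" where
  "loc T = {to_fract p / to_fract t | p t. t \<in> T}"

subsection \<open>The one-pair Cartan ring\<close>

text \<open>\<open>\<complex>[B]\<close> is \<^typ>\<open>complex poly\<close> and \<open>\<complex>(B)\<close> is \<^typ>\<open>complex poly fract\<close>.\<close>

definition cst :: "complex \<Rightarrow> complex poly fract" where
  "cst z = to_fract [:z:]"

definition BB :: "complex poly fract" where
  "BB = to_fract [:0, 1:]"

text \<open>\<open>shift k\<close> is \<open>\<sigma>\<^sup>k\<close>, that is \<open>R(B) \<mapsto> R(B + 2 i k)\<close>.\<close>

definition shift :: "int \<Rightarrow> complex poly \<Rightarrow> complex poly" where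
  "shift k p = p \<circ>\<^sub>p [:2 * \<i> * of_int k, 1:]"

definition d_pol :: "complex poly" where "d_pol = [:- \<i>, 1:]"
definition l_plus :: "complex \<Rightarrow> complex poly" where "l_plus s = [:s, - 2 * \<i>:]"
definition l_minus :: "complex \<Rightarrow> complex poly" where "l_minus s = [:s, 2 * \<i>:]"

definition S_min :: "complex \<Rightarrow> complex poly set" where
  "S_min s = mult_set hull (\<Union>k. {shift k d_pol, shift k (l_plus s), shift k (l_minus s)})"

definition A_min :: "complex \<Rightarrow> complex poly fract set" where
  "A_min s = loc (S_min s)"

text \<open>Denominator orbits are compared up to units of \<open>\<complex>[B]\<close>.\<close>

definition orbit_family :: "complex poly \<Rightarrow> complex poly set" where
  "orbit_family p = {smult z (shift k p) | z k. z \<noteq> 0}"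

subsection \<open>Cartan coefficients\<close>

definition beta :: "int \<Rightarrow> complex poly fract" where
  "beta j = (if j \<ge> 1 then BB + cst (of_int (2 * j - 1) * \<i>) else 1)"

definition alpha :: "int \<Rightarrow> complex poly fract" where
  "alpha j = (if j \<ge> 0 then 1 else BB + cst (of_int (2 * j + 1) * \<i>))"

definition Phi :: "complex \<Rightarrow> complex poly fract \<Rightarrow> complex poly fract" where
  "Phi s X = (cst (4 - s) + cst (2 * \<i>) * X) / (X - cst \<i>)"

definition Psi :: "complex \<Rightarrow> complex poly fract \<Rightarrow> complex poly fract" where
  "Psi s X = (cst (- s) - cst (2 * \<i>) * X) / (X - cst \<i>)"

definition sigma_plus :: "complex \<Rightarrow> int \<Rightarrow> complex poly fract" where
  "sigma_plus s c = beta (c + 1) * Phi s (BB + cst (2 * \<i> * of_int (c + 1)))"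

definition sigma_minus :: "complex \<Rightarrow> int \<Rightarrow> complex poly fract" where
  "sigma_minus s c = alpha (c - 1) * Psi s (BB + cst (2 * \<i> * of_int c))"

definition pi_plus :: "complex \<Rightarrow> int \<Rightarrow> complex poly fract" where
  "pi_plus s c = cst (- 1 / 4) * sigma_plus s c"

definition pi_minus :: "complex \<Rightarrow> int \<Rightarrow> complex poly fract" where
  "pi_minus s c = cst (- 1 / 4) * sigma_minus s c"

subsection \<open>The four-slot charge modules\<close>

text \<open>\<open>E0, Eth, Ebar, E2\<close> label \<open>x\<^sub>c\<close>, \<open>\<vartheta> x\<^sub>c\<^sub>+\<^sub>1\<close>, \<open>\<vartheta>bar x\<^sub>c\<^sub>-\<^sub>1\<close>, \<open>\<vartheta> \<vartheta>bar x\<^sub>c\<close>. A right-linear map \<open>F\<close> is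
  its matrix of right coefficients, \<open>F e\<^sub>x = (\<Sum>y. e\<^sub>y (F $ y $ x))\<close>, so composition is \<open>**\<close>.\<close>

datatype slot = E0 | Eth | Ebar | E2

instance slot :: finite
proof
  have "(UNIV :: slot set) = {E0, Eth, Ebar, E2}"
    using slot.exhaust by blast
  then show "finite (UNIV :: slot set)"
    by (metis finite.simps)
qed

definition slot_odd :: "slot \<Rightarrow> bool" where
  "slot_odd x \<longleftrightarrow> x = Eth \<or> x = Ebar"

text \<open>The right-linear map \<open>e\<^sub>x \<mapsto> e\<^sub>y a\<close>, zero on the other basis vectors.\<close>

definition arrow :: "'x::finite \<Rightarrow> 'x \<Rightarrow> 'k::zero \<Rightarrow> 'k^'x^'x" where
  "arrow x y a = (\<chi> v u. if v = y \<and> u = x then a else 0)"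

definition entries_in :: "'k set \<Rightarrow> 'k^'x^'x \<Rightarrow> bool" where
  "entries_in R F \<longleftrightarrow> (\<forall>y x. F $ y $ x \<in> R)"

definition odd_map :: "('x::finite \<Rightarrow> bool) \<Rightarrow> 'k::zero^'x^'x \<Rightarrow> bool" where
  "odd_map par F \<longleftrightarrow> (\<forall>y x. F $ y $ x \<noteq> 0 \<longrightarrow> par y \<noteq> par x)"

definition contracting :: "('x::finite \<Rightarrow> bool) \<Rightarrow> 'k::ring_1 set \<Rightarrow> 'k^'x^'x \<Rightarrow> 'k^'x^'x \<Rightarrow> bool" where
  "contracting par R Q h \<longleftrightarrow> entries_in R h \<and> odd_map par h \<and> Q ** h + h ** Q = mat 1"

text \<open>Contractibility over \<open>R\<close> presupposes that the complex itself is defined over \<open>R\<close>.\<close>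

definition contractible_over :: "('x::finite \<Rightarrow> bool) \<Rightarrow> 'k::ring_1 set \<Rightarrow> 'k^'x^'x \<Rightarrow> bool" where
  "contractible_over par R Q \<longleftrightarrow> entries_in R Q \<and> (\<exists>h. contracting par R Q h)"

definition Q_plus :: "complex \<Rightarrow> int \<Rightarrow> complex poly fract^slot^slot" where
  "Q_plus s c = arrow Eth E0 (pi_plus s c) + arrow E2 Ebar (cst (1 / (2 * \<i>)) * beta c)"

definition Q_minus :: "complex \<Rightarrow> int \<Rightarrow> complex poly fract^slot^slot" where
  "Q_minus s c = arrow Ebar E0 (pi_minus s c) + arrow E2 Eth (cst (1 / (2 * \<i>)) * alpha c)"

definition h_plus :: "complex \<Rightarrow> int \<Rightarrow> complex poly fract^slot^slot" where
  "h_plus s c = arrow E0 Eth (inverse (pi_plus s c)) + arrow Ebar E2 (cst (2 * \<i>) * inverse (beta c))"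

definition h_minus :: "complex \<Rightarrow> int \<Rightarrow> complex poly fract^slot^slot" where
  "h_minus s c = arrow E0 Ebar (inverse (pi_minus s c)) + arrow Eth E2 (cst (2 * \<i>) * inverse (alpha c))"

subsection \<open>Connection defects\<close>

text \<open>The extension of a ring map \<open>f\<close> on \<open>\<complex>[B]\<close>, injective into a field, to \<open>\<complex>(B)\<close>.\<close>

definition lift_rat :: "(complex poly \<Rightarrow> 'k::field) \<Rightarrow> complex poly fract \<Rightarrow> 'k" where
  "lift_rat f r = (THE y. \<exists>p t. t \<noteq> 0 \<and> r = to_fract p / to_fract t \<and> y = f p / f t)"

text \<open>The antilinear involution \<open>\<vartheta> \<leftrightarrow> \<vartheta>bar, a \<leftrightarrow> b\<close> preserves the order of products. Hence it fixes \<open>B = b a - i\<close>,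
  conjugates the scalars of \<open>\<complex>(B)\<close>, and sends \<open>e\<^sub>x\<^sub>,\<^sub>c\<close> to \<open>bar_sign x\<close> times \<open>e\<^sub>y\<^sub>,\<^sub>-\<^sub>c\<close> with \<open>y = bar_slot x\<close>
  (\<open>\<vartheta> \<vartheta>bar \<mapsto> \<vartheta>bar \<vartheta> = - \<vartheta> \<vartheta>bar\<close>). \<open>conj_map\<close> conjugates a map on charge \<open>c\<close> into one on charge \<open>- c\<close>.\<close>

definition conj_rat :: "complex poly fract \<Rightarrow> complex poly fract" where
  "conj_rat = lift_rat (\<lambda>p. to_fract (map_poly cnj p))"

definition bar_slot :: "slot \<Rightarrow> slot" where
  "bar_slot x = (case x of E0 \<Rightarrow> E0 | Eth \<Rightarrow> Ebar | Ebar \<Rightarrow> Eth | E2 \<Rightarrow> E2)"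

definition bar_sign :: "slot \<Rightarrow> complex poly fract" where
  "bar_sign x = (if x = E2 then - 1 else 1)"

definition conj_map :: "complex poly fract^slot^slot \<Rightarrow> complex poly fract^slot^slot" where
  "conj_map F = (\<chi> y x. bar_sign y * bar_sign x * conj_rat (F $ bar_slot y $ bar_slot x))"

definition c_q :: "complex \<Rightarrow> nat \<Rightarrow> complex" where
  "c_q q r = (1 - q ^ (2 * r)) / (2 * (1 - q))"

definition delta_q :: "complex \<Rightarrow> nat \<Rightarrow> complex" where
  "delta_q q m = (2 * of_nat m - (1 - q ^ (2 * m)) / (1 - q)) / 4"

definition kappa_plus :: "complex \<Rightarrow> int \<Rightarrow> complex poly fract" where
  "kappa_plus s c = cst (- 1 / 4) * sigma_plus s c * alpha c"

definition K_coeff :: "int \<Rightarrow> complex poly fract" where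
  "K_coeff c = cst (1 / (2 * \<i>)) * alpha (c - 1) * beta c"

definition P_plus :: "complex poly fract^slot^slot" where
  "P_plus = arrow Ebar Ebar 1 + arrow E2 E2 1"

text \<open>\<open>M_plus s q m r c\<close> is the defect on bosonic elements of degree \<open>r\<close>.\<close>

definition M_plus :: "complex \<Rightarrow> complex \<Rightarrow> nat \<Rightarrow> nat \<Rightarrow> int \<Rightarrow> complex poly fract^slot^slot" where
  "M_plus s q m r c = mat (cst (delta_q q m))
     + P_plus ** mat (kappa_plus s c - 1 - cst (c_q q (r + 1) / of_nat (r + 1)) * K_coeff c)"

text \<open>The parameters \<open>s\<close> and \<open>q\<close> are not conjugated: on them the involution acts as if they were real,
  as it does in passing from \<open>Q_plus\<close> to \<open>Q_minus\<close>.\<close>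

definition M_minus :: "complex \<Rightarrow> complex \<Rightarrow> nat \<Rightarrow> nat \<Rightarrow> int \<Rightarrow> complex poly fract^slot^slot" where
  "M_minus s q m r c = conj_map (M_plus (cnj s) (cnj q) m r (- c))"

definition N_plus :: "complex \<Rightarrow> complex \<Rightarrow> nat \<Rightarrow> nat \<Rightarrow> int \<Rightarrow> complex poly fract^slot^slot" where
  "N_plus s q m r c = - (h_plus s c ** M_plus s q m r c)"

definition N_minus :: "complex \<Rightarrow> complex \<Rightarrow> nat \<Rightarrow> nat \<Rightarrow> int \<Rightarrow> complex poly fract^slot^slot" where
  "N_minus s q m r c = - (h_minus s c ** M_minus s q m r c)"

subsection \<open>Triangular gauges\<close>

text \<open>The bosonic space has a homogeneous basis \<open>'v\<close> with degree function \<open>deg\<close>; the total space is the free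
  module on \<open>'v \<times> 'x\<close>, where \<open>'x\<close> indexes the charge module. A bosonic operator is given by its values
  \<open>'v \<Rightarrow> 'v \<Rightarrow>\<^sub>0 complex\<close> on the basis, so it commutes with the Cartan variables. \<open>gauge_gen k deg nn F\<close> is
  \<open>\<Sum>i. nn i \<otimes> F i\<close>, where \<open>F i r\<close> is the action of the \<open>i\<close>-th map on bosonic elements of degree \<open>r\<close> and
  \<open>k\<close> embeds the complex scalars. Bosonic elements are even, so no sign arises.\<close>

definition smul :: "'k::comm_ring_1 \<Rightarrow> ('b \<Rightarrow>\<^sub>0 'k) \<Rightarrow> ('b \<Rightarrow>\<^sub>0 'k)" where
  "smul a w = Poly_Mapping.map ((*) a) w"

definition lin_ext :: "('b \<Rightarrow> 'b \<Rightarrow>\<^sub>0 'k::comm_ring_1) \<Rightarrow> ('b \<Rightarrow>\<^sub>0 'k) \<Rightarrow> ('b \<Rightarrow>\<^sub>0 'k)" where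
  "lin_ext f w = (\<Sum>b\<in>Poly_Mapping.keys w. smul (Poly_Mapping.lookup w b) (f b))"

definition gauge_gen ::
  "(complex \<Rightarrow> 'k::field) \<Rightarrow> ('v \<Rightarrow> nat) \<Rightarrow> ('i::finite \<Rightarrow> 'v \<Rightarrow> 'v \<Rightarrow>\<^sub>0 complex)
     \<Rightarrow> ('i \<Rightarrow> nat \<Rightarrow> 'k^'x::finite^'x) \<Rightarrow> ('v \<times> 'x \<Rightarrow>\<^sub>0 'k) \<Rightarrow> ('v \<times> 'x \<Rightarrow>\<^sub>0 'k)" where
  "gauge_gen k deg nn F = lin_ext (\<lambda>(v, x). \<Sum>i\<in>UNIV. \<Sum>u\<in>Poly_Mapping.keys (nn i v). \<Sum>y\<in>UNIV.
     Poly_Mapping.single (u, y) (k (Poly_Mapping.lookup (nn i v) u) * F i (deg v) $ y $ x))"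

definition locally_nilpotent :: "('w \<Rightarrow> 'w::zero) \<Rightarrow> bool" where
  "locally_nilpotent X \<longleftrightarrow> (\<forall>w. \<exists>j. (X ^^ j) w = 0)"

text \<open>The exponential of a locally nilpotent operator, a finite sum on each vector.\<close>

definition nil_exp :: "(('b \<Rightarrow>\<^sub>0 'k::field) \<Rightarrow> ('b \<Rightarrow>\<^sub>0 'k)) \<Rightarrow> ('b \<Rightarrow>\<^sub>0 'k) \<Rightarrow> ('b \<Rightarrow>\<^sub>0 'k)" where
  "nil_exp X w = (\<Sum>j | (X ^^ j) w \<noteq> 0. smul (inverse (of_nat (fact j))) ((X ^^ j) w))"

definition coeffs_in :: "'k::field set \<Rightarrow> (('b \<Rightarrow>\<^sub>0 'k) \<Rightarrow> ('b \<Rightarrow>\<^sub>0 'k)) \<Rightarrow> bool" where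
  "coeffs_in R G \<longleftrightarrow> (\<forall>b b'. Poly_Mapping.lookup (G (Poly_Mapping.single b 1)) b' \<in> R)"

definition gauge_over ::
  "(complex \<Rightarrow> 'k::field) \<Rightarrow> 'k set \<Rightarrow> ('v \<Rightarrow> nat) \<Rightarrow> ('i::finite \<Rightarrow> 'v \<Rightarrow> 'v \<Rightarrow>\<^sub>0 complex)
     \<Rightarrow> ('i \<Rightarrow> nat \<Rightarrow> 'k^'x::finite^'x) \<Rightarrow> bool" where
  "gauge_over k R deg nn F \<longleftrightarrow>
     locally_nilpotent (gauge_gen k deg nn F) \<and> coeffs_in R (nil_exp (gauge_gen k deg nn F))"

subsection \<open>Several fermionic pairs\<close>

text \<open>The pairs are indexed by the finite linear order \<open>'n\<close>, which fixes the order of the tensor factors.\<close>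

type_synonym 'n mpol = "('n \<Rightarrow>\<^sub>0 nat) \<Rightarrow>\<^sub>0 complex"

definition mconst :: "complex \<Rightarrow> 'n mpol" where
  "mconst z = Poly_Mapping.single 0 z"

definition mvar :: "'n \<Rightarrow> 'n mpol" where
  "mvar j = Poly_Mapping.single (Poly_Mapping.single j 1) 1"

definition mcst :: "complex \<Rightarrow> 'n::linorder mpol fract" where
  "mcst z = to_fract (mconst z)"

text \<open>\<open>at_var j p\<close> is \<open>p(B\<^sub>j)\<close>, and \<open>iota j\<close> is its extension \<open>\<complex>(B) \<rightarrow> \<complex>(B\<^sub>1, \<dots>, B\<^sub>n)\<close>.\<close>

definition at_var :: "'n \<Rightarrow> complex poly \<Rightarrow> 'n mpol" where
  "at_var j p = poly (map_poly mconst p) (mvar j)"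

definition iota :: "'n::linorder \<Rightarrow> complex poly fract \<Rightarrow> 'n mpol fract" where
  "iota j = lift_rat (\<lambda>p. to_fract (at_var j p))"

text \<open>\<open>B\<^sub>j \<mapsto> B\<^sub>j + 2 i\<close>, the other variables being fixed.\<close>

definition mshift :: "'n::finite \<Rightarrow> 'n mpol \<Rightarrow> 'n mpol" where
  "mshift j p = (\<Sum>t\<in>Poly_Mapping.keys p. mconst (Poly_Mapping.lookup p t) *
     (\<Prod>i\<in>UNIV. (mvar i + mconst (if i = j then 2 * \<i> else 0)) ^ Poly_Mapping.lookup t i))"

definition S_pairs :: "complex \<Rightarrow> 'n mpol set" where
  "S_pairs s = mult_set hull (\<Union>j. at_var j ` S_min s)"

definition A_pairs :: "complex \<Rightarrow> 'n::linorder mpol fract set" where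
  "A_pairs s = loc (S_pairs s)"

text \<open>The tensor power of a \<open>\<complex>\<close>-subspace \<open>A\<close> of \<open>\<complex>(B)\<close> over the index type \<open>'n\<close>: formal combinations of families
  in \<open>A\<close>, modulo the span \<open>tensor_rel A\<close> of the multilinearity relations. \<open>tensor_mult\<close> is the
  canonical map \<open>a\<^sub>1 \<otimes> \<dots> \<otimes> a\<^sub>n \<mapsto> a\<^sub>1(B\<^sub>1) \<cdots> a\<^sub>n(B\<^sub>n)\<close> on formal combinations.\<close>

definition tensor_free :: "complex poly fract set \<Rightarrow> (('n \<Rightarrow> complex poly fract) \<Rightarrow>\<^sub>0 complex) set" where
  "tensor_free A = {t. \<forall>a\<in>Poly_Mapping.keys t. \<forall>j. a j \<in> A}"

inductive_set tensor_rel :: "complex poly fract set \<Rightarrow> (('n \<Rightarrow> complex poly fract) \<Rightarrow>\<^sub>0 complex) set"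
  for A :: "complex poly fract set" where
  zero: "0 \<in> tensor_rel A"
| add: "t \<in> tensor_rel A \<Longrightarrow> (\<And>i. a i \<in> A) \<Longrightarrow> u \<in> A \<Longrightarrow> v \<in> A \<Longrightarrow>
    t + (Poly_Mapping.single (a(j := u + v)) z
      - Poly_Mapping.single (a(j := u)) z - Poly_Mapping.single (a(j := v)) z) \<in> tensor_rel A"
| scale: "t \<in> tensor_rel A \<Longrightarrow> (\<And>i. a i \<in> A) \<Longrightarrow> u \<in> A \<Longrightarrow>
    t + (Poly_Mapping.single (a(j := cst w * u)) z - Poly_Mapping.single (a(j := u)) (w * z)) \<in> tensor_rel A"

definition tensor_mult ::
  "(('n \<Rightarrow> complex poly fract) \<Rightarrow>\<^sub>0 complex) \<Rightarrow> 'n::{finite,linorder} mpol fract" where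
  "tensor_mult t = (\<Sum>a\<in>Poly_Mapping.keys t. mcst (Poly_Mapping.lookup t a) * (\<Prod>j\<in>UNIV. iota j (a j)))"

definition iota_map ::
  "'n::linorder \<Rightarrow> complex poly fract^slot^slot \<Rightarrow> 'n mpol fract^slot^slot" where
  "iota_map j F = (\<chi> y x. iota j (F $ y $ x))"

definition tensor_odd :: "('n::finite \<Rightarrow> slot) \<Rightarrow> bool" where
  "tensor_odd x \<longleftrightarrow> odd (card {j. slot_odd (x j)})"

text \<open>\<open>hat j F\<close> is the action of an odd one-pair map \<open>F\<close> on the \<open>j\<close>-th factor of the graded tensor product,
  with the Koszul sign for passing the factors before \<open>j\<close>.\<close>

definition hat :: "'n::{finite,linorder} \<Rightarrow> complex poly fract^slot^slot
    \<Rightarrow> 'n mpol fract^('n \<Rightarrow> slot)^('n \<Rightarrow> slot)" where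
  "hat j F = (\<chi> y x. if \<forall>i. i \<noteq> j \<longrightarrow> y i = x i
     then (- 1) ^ card {i. i < j \<and> slot_odd (x i)} * iota j (F $ y j $ x j) else 0)"

definition Q_pairs :: "(int \<Rightarrow> complex poly fract^slot^slot) \<Rightarrow> ('n::{finite,linorder} \<Rightarrow> int)
    \<Rightarrow> 'n mpol fract^('n \<Rightarrow> slot)^('n \<Rightarrow> slot)" where
  "Q_pairs Q c = (\<Sum>j\<in>UNIV. hat j (Q (c j)))"

definition h_pairs :: "(int \<Rightarrow> complex poly fract^slot^slot) \<Rightarrow> ('n::{finite,linorder} \<Rightarrow> int)
    \<Rightarrow> 'n mpol fract^('n \<Rightarrow> slot)^('n \<Rightarrow> slot)" where
  "h_pairs h c = mat (mcst (1 / of_nat CARD('n))) ** (\<Sum>j\<in>UNIV. hat j (h (c j)))"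

end

theory Submission
  imports Defs
begin

text \<open>A tensor product of complexes is contractible as soon as one factor is: by the Koszul
  signs a homotopy acting on that factor alone contracts the total complex. Contractibility of the
  total complex therefore cannot detect the denominators of the other pairs, and minimality for
  several pairs is tested on the four-slot complex of every pair, or on the entries of the canonical
  homotopies, where the weight 1/n treats all factors alike. For one four-slot complex the form of a
  contracting h is irrelevant: at E0 and at E2 the diagonal entry of the anticommutator is a single
  product, which exhibits an inverse. This argument is carried out over an embedding f of C[B], so
  that the identity and the substitutions of B_j for B are both instances. Localizations are sets of
  fractions in a fixed fraction field, where division by 0 gives 0. The case that T contains 0 is
  split off, since the saturation is then everything.\<close>

text \<open>Up to nonzero scalars, \<open>pi_plus\<close> and \<open>pi_minus\<close> are shifts of \<open>l_plus\<close> and \<open>l_minus\<close>, divided on half of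
  the charges by a shift of \<open>d_pol\<close>, while \<open>beta\<close> and \<open>alpha\<close> are trivial on one half of the charges
  and run through the orbit of \<open>d_pol\<close> on the other. So all these coefficients are units of the
  localization, and since contractibility forces each of them to be a unit, no generator can be
  omitted. The gauge exponentials are finite sums because the homotopies strictly raise a bounded
  grading. For several pairs the Koszul signs make different factors anticommute, and every element
  of the tensor product of the localizations is brought to a common denominator \<open>e\<close> in each factor,
  where linear independence of the monomials in \<open>B\<^sub>1, \<dots>, B\<^sub>n\<close> gives injectivity.\<close>

subsection \<open>Localizations as subrings\<close>

definition is_subring :: "'a::ring_1 set \<Rightarrow> bool" where
  "is_subring R \<longleftrightarrow> 0 \<in> R \<and> 1 \<in> R \<and> (\<forall>x\<in>R. \<forall>y\<in>R. x + y \<in> R \<and> x * y \<in> R \<and> - x \<in> R)"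

context
  fixes R :: "'a::ring_1 set"
  assumes R: "is_subring R"
begin

lemma subring_zero: "0 \<in> R" and subring_one: "1 \<in> R"
  and subring_add: "x \<in> R \<Longrightarrow> y \<in> R \<Longrightarrow> x + y \<in> R"
  and subring_mult: "x \<in> R \<Longrightarrow> y \<in> R \<Longrightarrow> x * y \<in> R"
  and subring_uminus: "x \<in> R \<Longrightarrow> - x \<in> R"
  using R by (auto simp: is_subring_def)

lemma subring_diff: "x \<in> R \<Longrightarrow> y \<in> R \<Longrightarrow> x - y \<in> R"
  using subring_add[of x "- y"] subring_uminus by simp

lemma subring_sum: "(\<And>i. i \<in> I \<Longrightarrow> f i \<in> R) \<Longrightarrow> sum f I \<in> R"
  by (induction I rule: infinite_finite_induct) (auto intro: subring_zero subring_add)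

lemma subring_minus_one_power: "(- 1) ^ k \<in> R"
  by (induction k) (auto intro: subring_one subring_uminus)

end

lemma subring_prod:
  fixes R :: "'a::comm_ring_1 set"
  assumes "is_subring R" "\<And>i. i \<in> I \<Longrightarrow> f i \<in> R"
  shows "prod f I \<in> R"
  using assms(2)
  by (induction I rule: infinite_finite_induct)
    (auto intro: subring_one[OF assms(1)] subring_mult[OF assms(1)])

lemma mult_set_hull: "mult_set (mult_set hull X)"
  by (rule hull_in) (auto simp: mult_set_def)

lemma mult_set_one: "mult_set T \<Longrightarrow> 1 \<in> T"
  and mult_set_mult: "mult_set T \<Longrightarrow> x \<in> T \<Longrightarrow> y \<in> T \<Longrightarrow> x * y \<in> T"
  by (auto simp: mult_set_def)

lemma mult_set_prod:
  assumes "mult_set T" "\<And>i. i \<in> I \<Longrightarrow> f i \<in> T"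
  shows "prod f I \<in> T"
  using assms(2)
  by (induction I rule: infinite_finite_induct)
    (auto intro: mult_set_one[OF assms(1)] mult_set_mult[OF assms(1)])

lemma mult_set_saturation:
  assumes T: "mult_set T"
  shows "mult_set (saturation T)"
  unfolding mult_set_def
proof (intro conjI ballI)
  show "1 \<in> saturation T"
    using mult_set_one[OF T] by (auto simp: saturation_def intro: exI[of _ 1])
  fix x y assume "x \<in> saturation T" "y \<in> saturation T"
  then obtain u v where "x * u \<in> T" "y * v \<in> T"
    by (auto simp: saturation_def)
  then have "(x * u) * (y * v) \<in> T"
    by (rule mult_set_mult[OF T])
  then have "(x * y) * (u * v) \<in> T"
    by (simp add: ac_simps)
  then show "x * y \<in> saturation T"
    by (auto simp: saturation_def)
qed

lemma locI: "t \<in> T \<Longrightarrow> to_fract p / to_fract t \<in> loc T"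
  by (auto simp: loc_def)

lemma to_fract_in_loc: "mult_set T \<Longrightarrow> to_fract p \<in> loc T"
  using locI[of 1 T p] by (simp add: mult_set_one)

lemma inverse_to_fract_in_loc: "t \<in> T \<Longrightarrow> inverse (to_fract t) \<in> loc T"
  using locI[of t T 1] by (simp add: inverse_eq_divide)

lemma is_subring_loc:
  assumes T: "mult_set T" and "0 \<notin> T"
  shows "is_subring (loc T)"
  unfolding is_subring_def
proof (intro conjI ballI)
  show "0 \<in> loc T" "1 \<in> loc T"
    using to_fract_in_loc[OF T, of 0] to_fract_in_loc[OF T, of 1] by simp_all
  fix x y assume "x \<in> loc T" "y \<in> loc T"
  then obtain p t q u where *: "x = to_fract p / to_fract t" "y = to_fract q / to_fract u" "t \<in> T" "u \<in> T"
    by (auto simp: loc_def)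
  have nz: "t \<noteq> 0" "u \<noteq> 0"
    using * \<open>0 \<notin> T\<close> by auto
  have "x + y = to_fract (p * u + q * t) / to_fract (t * u)"
    "x * y = to_fract (p * q) / to_fract (t * u)" "- x = to_fract (- p) / to_fract t"
    using nz by (simp_all add: * field_simps)
  with * show "x + y \<in> loc T" "x * y \<in> loc T" "- x \<in> loc T"
    by (auto intro!: locI mult_set_mult[OF T] simp del: to_fract_add to_fract_mult to_fract_uminus)
qed

text \<open>No condition \<open>0 \<notin> T\<close> is needed: a junk fraction with denominator \<open>0\<close> is \<open>0\<close>, hence not an inverse.\<close>

lemma saturationI_unit:
  assumes T: "mult_set T" and x: "x \<in> loc T" "to_fract p * x = 1"
  shows "p \<in> saturation T"
proof -
  obtain q t where *: "x = to_fract q / to_fract t" "t \<in> T"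
    using x by (auto simp: loc_def)
  have "t \<noteq> 0"
    using x * by auto
  then have "to_fract (p * q) = to_fract t"
    using x * by (simp add: field_simps)
  then have "p * q = t"
    unfolding to_fract_eq_iff .
  with * show ?thesis
    by (auto simp: saturation_def)
qed

lemma saturation_UNIV: "0 \<in> T \<Longrightarrow> saturation T = UNIV"
  by (auto simp: saturation_def intro!: exI[of _ 0])

subsection \<open>Extending embeddings of the polynomial ring to rational functions\<close>

text \<open>A ring homomorphism with trivial kernel keeps denominators nonzero and so extends to
  fractions. No C-linearity is imposed because conjugation of coefficients has to be an instance,
  next to the identity and the substitutions \<open>at_var j\<close>.\<close>

locale poly_embedding =
  fixes f :: "complex poly \<Rightarrow> 'r::idom"
  assumes f_one: "f 1 = 1"
    and f_add: "f (p + q) = f p + f q"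
    and f_mult: "f (p * q) = f p * f q"
    and f_zeroD: "f p = 0 \<Longrightarrow> p = 0"
begin

definition ext :: "complex poly fract \<Rightarrow> 'r fract" where
  "ext = lift_rat (\<lambda>p. to_fract (f p))"

lemma f_zero: "f 0 = 0"
  using f_add[of 0 0] by (metis add_cancel_right_left add.right_neutral)

lemma f_eq_0_iff: "f p = 0 \<longleftrightarrow> p = 0"
  using f_zero f_zeroD by auto

text \<open>Cross-multiplying two representations of one fraction shows that the description in
  \<open>lift_rat\<close> determines a unique value.\<close>

lemma ext_quot:
  assumes "t \<noteq> 0"
  shows "ext (to_fract p / to_fract t) = to_fract (f p) / to_fract (f t)"
  unfolding ext_def lift_rat_def
proof (rule the_equality)
  fix y assume "\<exists>p' t'. t' \<noteq> 0 \<and> to_fract p / to_fract t = to_fract p' / to_fract t'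
      \<and> y = to_fract (f p') / to_fract (f t')"
  then obtain p' t' where *: "t' \<noteq> 0" "to_fract p / to_fract t = to_fract p' / to_fract t'"
      "y = to_fract (f p') / to_fract (f t')"
    by blast
  from * assms have "to_fract (p * t') = to_fract (p' * t)"
    by (simp add: field_simps)
  then have "f (p * t') = f (p' * t)"
    unfolding to_fract_eq_iff by simp
  then have "to_fract (f p) * to_fract (f t') = to_fract (f p') * to_fract (f t)"
    by (simp only: f_mult flip: to_fract_mult)
  then show "y = to_fract (f p) / to_fract (f t)"
    using * assms by (simp add: frac_eq_eq f_eq_0_iff)
qed (use assms in blast)

lemma fract_quot_cases:
  obtains p t :: "complex poly" where "t \<noteq> 0" "x = to_fract p / to_fract t"
  by (cases x) (auto simp: Fract_conv_to_fract)

lemma ext_to_fract: "ext (to_fract p) = to_fract (f p)"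
  using ext_quot[of 1 p] by (simp add: f_one)

lemma ext_zero [simp]: "ext 0 = 0" and ext_one [simp]: "ext 1 = 1"
  using ext_to_fract[of 0] ext_to_fract[of 1] by (simp_all add: f_zero f_one)

lemma ext_add: "ext (x + y) = ext x + ext y"
proof -
  obtain p t where x: "t \<noteq> 0" "x = to_fract p / to_fract t" by (rule fract_quot_cases)
  obtain q u where y: "u \<noteq> 0" "y = to_fract q / to_fract u" by (rule fract_quot_cases)
  have "x + y = to_fract (p * u + q * t) / to_fract (t * u)"
    using x y by (simp add: field_simps)
  also have "ext \<dots> = to_fract (f (p * u + q * t)) / to_fract (f (t * u))"
    using x y by (intro ext_quot) auto
  also have "\<dots> = ext x + ext y"
    unfolding x(2) y(2) ext_quot[OF x(1)] ext_quot[OF y(1)]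
    using x(1) y(1) by (simp add: f_add f_mult field_simps f_eq_0_iff)
  finally show ?thesis .
qed

lemma ext_mult: "ext (x * y) = ext x * ext y"
proof -
  obtain p t where x: "t \<noteq> 0" "x = to_fract p / to_fract t" by (rule fract_quot_cases)
  obtain q u where y: "u \<noteq> 0" "y = to_fract q / to_fract u" by (rule fract_quot_cases)
  have "x * y = to_fract (p * q) / to_fract (t * u)"
    using x y by (simp add: field_simps)
  also have "ext \<dots> = to_fract (f (p * q)) / to_fract (f (t * u))"
    using x y by (intro ext_quot) auto
  also have "\<dots> = ext x * ext y"
    unfolding x(2) y(2) ext_quot[OF x(1)] ext_quot[OF y(1)]
    by (simp add: f_mult)
  finally show ?thesis .
qed

lemma ext_sum: "ext (sum g I) = (\<Sum>i\<in>I. ext (g i))"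
  by (induction I rule: infinite_finite_induct) (auto simp: ext_add)

lemma ext_inverse: "ext (inverse x) = inverse (ext x)"
proof (cases "x = 0")
  case False
  then have "ext x * ext (inverse x) = 1"
    by (simp flip: ext_mult)
  then show ?thesis
    by (simp add: inverse_unique)
qed simp

lemma ext_loc:
  assumes "x \<in> loc S" "0 \<notin> S" "\<And>p. p \<in> S \<Longrightarrow> f p \<in> T"
  shows "ext x \<in> loc T"
proof -
  obtain p t where x: "x = to_fract p / to_fract t" "t \<in> S"
    using assms(1) by (auto simp: loc_def)
  with assms(2) have "t \<noteq> 0"
    by auto
  with x assms(3) show ?thesis
    by (simp add: ext_quot locI)
qed

end

interpretation ident: poly_embedding "\<lambda>p. p"
  by unfold_locales auto

lemma ext_ident: "ident.ext x = x"
proof -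
  obtain p t :: "complex poly" where "t \<noteq> 0" "x = to_fract p / to_fract t"
    by (rule ident.fract_quot_cases)
  then show ?thesis
    by (simp add: ident.ext_quot)
qed

subsection \<open>Denominators and Cartan coefficients\<close>

lemma shift_linear: "shift k [:u, v:] = [:u + 2 * \<i> * of_int k * v, v:]"
  by (simp add: shift_def pcompose_pCons algebra_simps)

lemma shift_d_pol: "shift k d_pol = [:of_int (2 * k - 1) * \<i>, 1:]"
  and shift_l_plus: "shift k (l_plus s) = [:s + of_int (4 * k), - 2 * \<i>:]"
  and shift_l_minus: "shift k (l_minus s) = [:s - of_int (4 * k), 2 * \<i>:]"
  by (simp_all add: d_pol_def l_plus_def l_minus_def shift_linear algebra_simps)

lemma mult_set_S_min: "mult_set (S_min s)"
  unfolding S_min_def by (rule mult_set_hull)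

lemma S_min_d: "shift k d_pol \<in> S_min s"
  and S_min_l_plus: "shift k (l_plus s) \<in> S_min s"
  and S_min_l_minus: "shift k (l_minus s) \<in> S_min s"
  unfolding S_min_def by (blast intro: hull_inc)+

lemma S_min_subsetI:
  assumes "mult_set X" "\<And>k. shift k d_pol \<in> X" "\<And>k. shift k (l_plus s) \<in> X"
    "\<And>k. shift k (l_minus s) \<in> X"
  shows "S_min s \<subseteq> X"
  unfolding S_min_def using assms by (intro hull_minimal) auto

lemma zero_notin_S_min: "0 \<notin> S_min s"
proof -
  have "S_min s \<subseteq> {p. p \<noteq> 0}"
    by (rule S_min_subsetI) (auto simp: mult_set_def shift_d_pol shift_l_plus shift_l_minus)
  then show ?thesis
    by auto
qed

lemma is_subring_A_min: "is_subring (A_min s)"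
  unfolding A_min_def by (rule is_subring_loc[OF mult_set_S_min zero_notin_S_min])

lemma to_fract_in_A_min: "to_fract p \<in> A_min s"
  unfolding A_min_def by (rule to_fract_in_loc[OF mult_set_S_min])

lemma inverse_in_A_min: "t \<in> S_min s \<Longrightarrow> inverse (to_fract t) \<in> A_min s"
  unfolding A_min_def by (rule inverse_to_fract_in_loc)

lemma cst_in_A_min: "cst z \<in> A_min s"
  unfolding cst_def by (rule to_fract_in_A_min)

lemma cst_1 [simp]: "cst 1 = 1" and cst_0 [simp]: "cst 0 = 0"
  and cst_add: "cst (z + w) = cst z + cst w"
  and cst_mult: "cst (z * w) = cst z * cst w"
  and cst_eq_0_iff [simp]: "cst z = 0 \<longleftrightarrow> z = 0"
  by (simp_all add: cst_def flip: to_fract_add to_fract_mult one_pCons)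

lemma cst_inverse: "cst (inverse z) = inverse (cst z)"
proof (cases "z = 0")
  case False
  then have "cst z * cst (inverse z) = 1"
    by (simp flip: cst_mult)
  then show ?thesis
    by (simp add: inverse_unique)
qed simp

lemma beta_eq: "beta c = (if c \<ge> 1 then to_fract (shift c d_pol) else 1)"
  by (simp add: beta_def BB_def cst_def shift_d_pol flip: to_fract_add)

text \<open>The constant (2c+1)i belongs to the shift by c+1. Thus \<open>beta\<close> supplies the
  shifts k \<ge> 1 of \<open>d_pol\<close> and \<open>alpha\<close> the shifts k \<le> 0: together
  they cover the whole orbit, without overlap.\<close>

lemma alpha_eq: "alpha c = (if c \<ge> 0 then 1 else to_fract (shift (c + 1) d_pol))"
  by (simp add: alpha_def BB_def cst_def shift_d_pol flip: to_fract_add)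

lemma to_fract_d_nz: "to_fract (shift k d_pol) \<noteq> 0"
  by (simp add: shift_d_pol)

text \<open>The 4 in \<open>Phi\<close> offsets the argument c+1, so the numerator is shifted by c
  while the denominator is shifted by c+1. For c \<ge> 0 the factor \<open>beta (c + 1)\<close>
  equals this denominator and cancels it; for c < 0 it is 1. The minus signs of the numerator and of
  -1/4 cancel.\<close>

lemma pi_plus_eq:
  "pi_plus s c = cst (1 / 4) * to_fract (shift c (l_plus s))
     * (if c \<ge> 0 then 1 else inverse (to_fract (shift (c + 1) d_pol)))"
proof -
  have num: "[:4 - s:] + [:2 * \<i>:] * ([:0, 1:] + [:2 * \<i> * of_int (c + 1):]) = - shift c (l_plus s)"
    by (simp add: shift_l_plus algebra_simps)
  have den: "[:0, 1:] + [:2 * \<i> * of_int (c + 1):] - [:\<i>:] = shift (c + 1) d_pol"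
    by (simp add: shift_d_pol algebra_simps)
  have "Phi s (BB + cst (2 * \<i> * of_int (c + 1)))
      = to_fract (- shift c (l_plus s)) / to_fract (shift (c + 1) d_pol)"
    unfolding Phi_def BB_def cst_def num [symmetric] den [symmetric]
    by (simp only: to_fract_add to_fract_diff to_fract_mult)
  then have "pi_plus s c = cst (- 1 / 4) * (beta (c + 1)
      * (- to_fract (shift c (l_plus s)) * inverse (to_fract (shift (c + 1) d_pol))))"
    by (simp only: pi_plus_def sigma_plus_def divide_inverse to_fract_uminus)
  moreover have "cst (- 1 / 4) = - cst (1 / 4)"
    by (simp add: cst_def flip: to_fract_uminus)
  ultimately show ?thesis
    using to_fract_d_nz[of "c + 1"] by (simp add: beta_eq)
qed

text \<open>Here numerator and denominator are both shifted by c, and \<open>alpha (c - 1)\<close>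
  is the denominator exactly when c \<le> 0.\<close>

lemma pi_minus_eq:
  "pi_minus s c = cst (1 / 4) * to_fract (shift c (l_minus s))
     * (if c \<le> 0 then 1 else inverse (to_fract (shift c d_pol)))"
proof -
  have num: "[:- s:] - [:2 * \<i>:] * ([:0, 1:] + [:2 * \<i> * of_int c:]) = - shift c (l_minus s)"
    by (simp add: shift_l_minus algebra_simps)
  have den: "[:0, 1:] + [:2 * \<i> * of_int c:] - [:\<i>:] = shift c d_pol"
    by (simp add: shift_d_pol algebra_simps)
  have "Psi s (BB + cst (2 * \<i> * of_int c))
      = to_fract (- shift c (l_minus s)) / to_fract (shift c d_pol)"
    unfolding Psi_def BB_def cst_def num [symmetric] den [symmetric]
    by (simp only: to_fract_add to_fract_diff to_fract_mult)
  then have "pi_minus s c = cst (- 1 / 4) * (alpha (c - 1)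
      * (- to_fract (shift c (l_minus s)) * inverse (to_fract (shift c d_pol))))"
    by (simp only: pi_minus_def sigma_minus_def divide_inverse to_fract_uminus)
  moreover have "cst (- 1 / 4) = - cst (1 / 4)"
    by (simp add: cst_def flip: to_fract_uminus)
  ultimately show ?thesis
    using to_fract_d_nz[of c] by (simp add: alpha_eq)
qed

lemma beta_nz: "beta c \<noteq> 0" and alpha_nz: "alpha c \<noteq> 0"
  using to_fract_d_nz by (auto simp: beta_eq alpha_eq)

lemma pi_plus_nz: "pi_plus s c \<noteq> 0" and pi_minus_nz: "pi_minus s c \<noteq> 0"
  by (simp_all add: pi_plus_eq pi_minus_eq shift_d_pol shift_l_plus shift_l_minus)

lemma beta_in: "beta c \<in> A_min s" "inverse (beta c) \<in> A_min s"
  and alpha_in: "alpha c \<in> A_min s" "inverse (alpha c) \<in> A_min s"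
  by (auto simp: beta_eq alpha_eq to_fract_in_A_min inverse_in_A_min S_min_d
      subring_one[OF is_subring_A_min])

lemma pi_plus_in: "pi_plus s c \<in> A_min s" "inverse (pi_plus s c) \<in> A_min s"
  and pi_minus_in: "pi_minus s c \<in> A_min s" "inverse (pi_minus s c) \<in> A_min s"
  by (auto simp: pi_plus_eq pi_minus_eq inverse_mult_distrib simp flip: cst_inverse
      intro!: subring_mult[OF is_subring_A_min] subring_one[OF is_subring_A_min]
        cst_in_A_min to_fract_in_A_min inverse_in_A_min S_min_d S_min_l_plus S_min_l_minus)

lemma sigma_plus_in: "sigma_plus s c \<in> A_min s"
proof -
  have "sigma_plus s c = cst (- 4) * pi_plus s c"
    by (simp add: pi_plus_def flip: cst_mult mult.assoc)
  then show ?thesis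
    by (simp add: subring_mult[OF is_subring_A_min] cst_in_A_min pi_plus_in)
qed

subsection \<open>Conjugation\<close>

interpretation cnj: poly_embedding "map_poly cnj"
proof
  show "map_poly cnj 1 = 1"
    by simp
  show "map_poly cnj (p + q) = map_poly cnj p + map_poly cnj q" for p q
    by (rule poly_eqI) (simp add: coeff_map_poly)
  show "map_poly cnj (p * q) = map_poly cnj p * map_poly cnj q" for p q
    by (rule poly_eqI) (simp add: coeff_map_poly coeff_mult)
  show "map_poly cnj p = 0 \<Longrightarrow> p = 0" for p
    by (simp add: map_poly_eq_0_iff)
qed

lemma conj_rat_eq: "conj_rat = cnj.ext"
  by (simp add: conj_rat_def cnj.ext_def)

text \<open>Conjugation fixes B and reverses shifts. It exchanges \<open>l_plus\<close> and
  \<open>l_minus\<close> and keeps the orbit of \<open>d_pol\<close>, where k becomes 1 - k because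
  -i goes to i, the constant term of \<open>shift 1 d_pol\<close>. The parameter
  \<open>cnj s\<close> is the one fed to \<open>M_plus\<close> inside
  \<open>M_minus\<close>.\<close>

lemma map_poly_cnj_S_min:
  assumes "p \<in> S_min (cnj s)"
  shows "map_poly cnj p \<in> S_min s"
proof -
  have "S_min (cnj s) \<subseteq> {p. map_poly cnj p \<in> S_min s}"
  proof (rule S_min_subsetI)
    show "mult_set {p. map_poly cnj p \<in> S_min s}"
      using mult_set_S_min[of s] by (auto simp: mult_set_def cnj.f_mult)
    fix k
    have "map_poly cnj (shift k d_pol) = shift (1 - k) d_pol"
      "map_poly cnj (shift k (l_plus (cnj s))) = shift (- k) (l_minus s)"
      "map_poly cnj (shift k (l_minus (cnj s))) = shift (- k) (l_plus s)"
      by (simp_all add: shift_d_pol shift_l_plus shift_l_minus map_poly_pCons algebra_simps)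
    then show "shift k d_pol \<in> {p. map_poly cnj p \<in> S_min s}"
      "shift k (l_plus (cnj s)) \<in> {p. map_poly cnj p \<in> S_min s}"
      "shift k (l_minus (cnj s)) \<in> {p. map_poly cnj p \<in> S_min s}"
      by (simp_all add: S_min_d S_min_l_plus S_min_l_minus)
  qed
  with assms show ?thesis
    by auto
qed

lemma conj_rat_in: "x \<in> A_min (cnj s) \<Longrightarrow> conj_rat x \<in> A_min s"
  unfolding conj_rat_eq A_min_def
  using cnj.ext_loc zero_notin_S_min map_poly_cnj_S_min by blast

subsection \<open>The one-pair complexes\<close>

lemma UNIV_slot: "UNIV = {E0, Eth, Ebar, E2}"
  using slot.exhaust by auto

lemma sum_slot: "sum f (UNIV :: slot set) = f E0 + f Eth + f Ebar + f E2"
  for f :: "slot \<Rightarrow> 'a::comm_monoid_add"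
  by (simp add: UNIV_slot add.assoc)

lemma arrow_nth: "arrow x y a $ v $ u = (if v = y \<and> u = x then a else 0)"
  by (simp add: arrow_def)

lemma mat_nth: "mat a $ v $ u = (if v = u then a else 0)"
  by (simp add: mat_def)

lemma matrix_mult_nth: "(A ** B) $ v $ u = (\<Sum>w\<in>UNIV. A $ v $ w * B $ w $ u)"
  by (simp add: matrix_matrix_mult_def)

lemma slot_matrix_eqI:
  assumes "\<And>y x. y \<in> {E0, Eth, Ebar, E2} \<Longrightarrow> x \<in> {E0, Eth, Ebar, E2} \<Longrightarrow> F $ y $ x = G $ y $ x"
  shows "F = (G :: 'k^slot^slot)"
  using assms UNIV_slot by (auto simp: vec_eq_iff)

context
  fixes R :: "'k::comm_ring_1 set"
  assumes R: "is_subring R"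
begin

lemma entries_in_arrow: "a \<in> R \<Longrightarrow> entries_in R (arrow x y a)"
  and entries_in_mat: "a \<in> R \<Longrightarrow> entries_in R (mat a)"
  using subring_zero[OF R] by (auto simp: entries_in_def arrow_nth mat_nth)

lemma entries_in_add: "entries_in R F \<Longrightarrow> entries_in R G \<Longrightarrow> entries_in R (F + G)"
  and entries_in_uminus: "entries_in R F \<Longrightarrow> entries_in R (- F)"
  and entries_in_mult: "entries_in R F \<Longrightarrow> entries_in R G \<Longrightarrow> entries_in R (F ** G)"
  by (auto simp: entries_in_def matrix_mult_nth
      intro!: subring_add[OF R] subring_uminus[OF R] subring_sum[OF R] subring_mult[OF R])

lemma entries_in_sum: "(\<And>i. i \<in> I \<Longrightarrow> entries_in R (F i)) \<Longrightarrow> entries_in R (sum F I)"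
  by (auto simp: entries_in_def intro!: subring_sum[OF R])

end

lemmas A_min_entries =
  entries_in_arrow[OF is_subring_A_min] entries_in_mat[OF is_subring_A_min]
  entries_in_add[OF is_subring_A_min] entries_in_uminus[OF is_subring_A_min]
  entries_in_mult[OF is_subring_A_min]

lemmas A_min_closed =
  subring_one[OF is_subring_A_min] subring_mult[OF is_subring_A_min]
  subring_diff[OF is_subring_A_min] cst_in_A_min beta_in alpha_in pi_plus_in pi_minus_in sigma_plus_in

lemma Q_entries: "entries_in (A_min s) (Q_plus s c)" "entries_in (A_min s) (Q_minus s c)"
  and h_entries: "entries_in (A_min s) (h_plus s c)" "entries_in (A_min s) (h_minus s c)"
  unfolding Q_plus_def Q_minus_def h_plus_def h_minus_def
  by (intro A_min_entries A_min_closed)+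

lemma Q_odd: "odd_map slot_odd (Q_plus s c)" "odd_map slot_odd (Q_minus s c)"
  and h_odd: "odd_map slot_odd (h_plus s c)" "odd_map slot_odd (h_minus s c)"
  by (auto simp: odd_map_def Q_plus_def Q_minus_def h_plus_def h_minus_def arrow_nth slot_odd_def)

text \<open>Every arrow of h reverses an arrow of Q with the inverse coefficient. The composite Q h
  is the identity on the two targets of Q, and h Q on its two sources; together these are the four
  slots.\<close>

lemma Q_h_plus: "Q_plus s c ** h_plus s c + h_plus s c ** Q_plus s c = mat 1"
  and Q_h_minus: "Q_minus s c ** h_minus s c + h_minus s c ** Q_minus s c = mat 1"
proof -
  have [simp]: "cst z * x * (cst w * inverse x) = 1" "cst w * inverse x * (cst z * x) = 1"
    if "z * w = 1" "x \<noteq> 0" for z w x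
  proof -
    have "cst z * x * (cst w * inverse x) = cst (z * w) * (x * inverse x)"
      by (simp only: cst_mult ac_simps)
    then show "cst z * x * (cst w * inverse x) = 1" "cst w * inverse x * (cst z * x) = 1"
      using that by (simp_all add: mult.commute)
  qed
  note [simp] = pi_plus_nz pi_minus_nz beta_nz alpha_nz
  show "Q_plus s c ** h_plus s c + h_plus s c ** Q_plus s c = mat 1"
    "Q_minus s c ** h_minus s c + h_minus s c ** Q_minus s c = mat 1"
    by (rule slot_matrix_eqI,
      auto simp: matrix_mult_nth sum_slot mat_nth arrow_nth Q_plus_def h_plus_def Q_minus_def h_minus_def)+
qed

lemma contracting_one_pair:
  "contracting slot_odd (A_min s) (Q_plus s c) (h_plus s c)"
  "contracting slot_odd (A_min s) (Q_minus s c) (h_minus s c)"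
  by (simp_all add: contracting_def h_entries h_odd Q_h_plus Q_h_minus)

subsection \<open>The connection defects\<close>

lemma M_plus_entries: "entries_in (A_min s) (M_plus s q m r c)"
  unfolding M_plus_def P_plus_def kappa_plus_def K_coeff_def
  by (intro A_min_entries A_min_closed)

lemma M_minus_entries: "entries_in (A_min s) (M_minus s q m r c)"
proof -
  have "bar_sign x \<in> A_min s" for x
    by (simp add: bar_sign_def A_min_closed subring_uminus[OF is_subring_A_min])
  moreover have "conj_rat (M_plus (cnj s) (cnj q) m r (- c) $ y $ x) \<in> A_min s" for y x
    using M_plus_entries[of "cnj s"] by (intro conj_rat_in) (auto simp: entries_in_def)
  ultimately show ?thesis
    by (auto simp: M_minus_def conj_map_def entries_in_def intro!: A_min_closed)
qed

lemma N_entries: "entries_in (A_min s) (N_plus s q m r c)" "entries_in (A_min s) (N_minus s q m r c)"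
  unfolding N_plus_def N_minus_def
  by (intro A_min_entries h_entries M_plus_entries M_minus_entries)+

lemma M_plus_diagonal: "y \<noteq> x \<Longrightarrow> M_plus s q m r c $ y $ x = 0"
  by (cases y; cases x) (auto simp: M_plus_def P_plus_def matrix_mult_nth sum_slot mat_nth arrow_nth)

lemma M_minus_diagonal: "y \<noteq> x \<Longrightarrow> M_minus s q m r c $ y $ x = 0"
proof -
  assume "y \<noteq> x"
  then have "bar_slot y \<noteq> bar_slot x"
    by (cases y; cases x) (auto simp: bar_slot_def)
  then show ?thesis
    by (simp add: M_minus_def conj_map_def M_plus_diagonal conj_rat_eq)
qed

lemma mult_diagonal_nth:
  fixes F G :: "'k::comm_ring_1^'x^'x"
  assumes "\<And>y x. y \<noteq> x \<Longrightarrow> G $ y $ x = 0"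
  shows "(F ** G) $ y $ x = F $ y $ x * G $ x $ x"
proof -
  have "(F ** G) $ y $ x = (\<Sum>w\<in>UNIV. if w = x then F $ y $ x * G $ x $ x else 0)"
    unfolding matrix_mult_nth by (intro sum.cong) (auto simp: assms)
  then show ?thesis
    by simp
qed

text \<open>The number of factors theta in a slot; both arrows of \<open>h_plus\<close> insert one.
  Its companion \<open>level_minus\<close> counts the conjugate generator.\<close>

definition level_plus :: "slot \<Rightarrow> nat" where
  "level_plus x = (if x = Eth \<or> x = E2 then 1 else 0)"

definition level_minus :: "slot \<Rightarrow> nat" where
  "level_minus x = (if x = Ebar \<or> x = E2 then 1 else 0)"

text \<open>The defects are diagonal, so N can have nonzero entries only along the arrows of
  h.\<close>

lemma N_plus_level: "N_plus s q m r c $ y $ x \<noteq> 0 \<Longrightarrow> level_plus x < level_plus y"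
  and N_minus_level: "N_minus s q m r c $ y $ x \<noteq> 0 \<Longrightarrow> level_minus x < level_minus y"
  by (auto simp: N_plus_def N_minus_def mult_diagonal_nth M_plus_diagonal M_minus_diagonal
      h_plus_def h_minus_def arrow_nth level_plus_def level_minus_def split: if_splits)

subsection \<open>Triangular gauges\<close>

lemma lookup_smul: "Poly_Mapping.lookup (smul a w) b = a * Poly_Mapping.lookup w b"
  by (simp add: smul_def Poly_Mapping.map.rep_eq when_def)

lemma lookup_lin_ext: "Poly_Mapping.lookup (lin_ext f w) b'
    = (\<Sum>b\<in>Poly_Mapping.keys w. Poly_Mapping.lookup w b * Poly_Mapping.lookup (f b) b')"
  by (simp add: lin_ext_def lookup_sum lookup_smul)

text \<open>The generator strictly raises \<open>lev\<close>, which takes finitely many values.\<close>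

lemma gauge_overI:
  fixes k :: "complex \<Rightarrow> 'k::field" and F :: "'i::finite \<Rightarrow> nat \<Rightarrow> 'k^'x::finite^'x" and lev :: "'x \<Rightarrow> nat"
  assumes R: "is_subring R" and k: "\<And>z. k z \<in> R" and fact: "\<And>j. inverse (of_nat (fact j)) \<in> R"
    and F: "\<And>i r. entries_in R (F i r)"
    and lev: "\<And>i r y x. F i r $ y $ x \<noteq> 0 \<Longrightarrow> lev x < lev y"
  shows "gauge_over k R deg nn F"
proof -
  define g where "g = (\<lambda>(v, x). \<Sum>i\<in>UNIV. \<Sum>u\<in>Poly_Mapping.keys (nn i v). \<Sum>y\<in>UNIV.
     Poly_Mapping.single (u, y) (k (Poly_Mapping.lookup (nn i v) u) * F i (deg v) $ y $ x))"
  define X where "X = gauge_gen k deg nn F"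
  have X: "X = lin_ext g"
    by (simp add: X_def g_def gauge_gen_def)
  \<comment> \<open>The bosonic operators are arbitrary, so nilpotency has to come from the slot
    index, the second component, alone.\<close>
  have g_lev: "lev (snd b) < lev (snd b')" if nz: "Poly_Mapping.lookup (g b) b' \<noteq> 0" for b b'
  proof (rule ccontr)
    assume not: "\<not> ?thesis"
    obtain v x where b: "b = (v, x)"
      by (cases b)
    have "F i (deg v) $ snd b' $ x = 0" for i
      using not lev[of i "deg v" "snd b'" x] b by auto
    then have "Poly_Mapping.lookup (g b) b' = 0"
      by (auto simp: b g_def lookup_sum lookup_single when_def intro!: sum.neutral)
    with nz show False
      by simp
  qed
  have g_in: "Poly_Mapping.lookup (g b) b' \<in> R" for b b'
    using F by (auto simp: g_def lookup_sum lookup_single when_def entries_in_def case_prod_unfold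
        intro!: subring_sum[OF R] subring_mult[OF R] k subring_zero[OF R])
  \<comment> \<open>Every application gains at least one level, so \<open>X ^^ j\<close> reaches
    only slots of level at least j; one step beyond the highest level everything vanishes.\<close>
  have X_lev: "j \<le> lev (snd b)" if "Poly_Mapping.lookup ((X ^^ j) w) b \<noteq> 0" for j w b
    using that
  proof (induction j arbitrary: b)
    case (Suc j)
    then have "(\<Sum>b'\<in>Poly_Mapping.keys ((X ^^ j) w).
        Poly_Mapping.lookup ((X ^^ j) w) b' * Poly_Mapping.lookup (g b') b) \<noteq> 0"
      by (simp add: X lookup_lin_ext)
    then obtain b' where b': "Poly_Mapping.lookup ((X ^^ j) w) b' * Poly_Mapping.lookup (g b') b \<noteq> 0"
      by (meson sum.neutral)
    then have "j \<le> lev (snd b')" "lev (snd b') < lev (snd b)"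
      using Suc.IH[of b'] g_lev[of b' b] by auto
    then show ?case
      by simp
  qed simp
  have X_in: "Poly_Mapping.lookup ((X ^^ j) w) b \<in> R"
    if "\<And>b. Poly_Mapping.lookup w b \<in> R" for j w b
    by (induction j arbitrary: b)
      (auto simp: that X lookup_lin_ext g_in intro!: subring_sum[OF R] subring_mult[OF R])
  have "locally_nilpotent X"
    unfolding locally_nilpotent_def
  proof (intro allI exI)
    fix w
    define L where "L = Suc (Max (range lev))"
    have "lev y < L" for y
      by (simp add: L_def less_Suc_eq_le)
    then have "Poly_Mapping.lookup ((X ^^ L) w) b = 0" for b
      using X_lev[of L w b] leD by blast
    then show "(X ^^ L) w = 0"
      by (intro poly_mapping_eqI) simp
  qed
  moreover have "coeffs_in R (nil_exp X)"
    unfolding coeffs_in_def nil_exp_def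
    by (auto simp: lookup_sum lookup_smul lookup_single when_def
        intro!: subring_sum[OF R] subring_mult[OF R] fact X_in subring_zero[OF R] subring_one[OF R])
  ultimately show ?thesis
    by (simp add: gauge_over_def X_def)
qed

lemma of_nat_cst: "of_nat n = cst (of_nat n)"
  by (induction n) (simp_all add: cst_add)

lemma inverse_of_nat_in_A_min: "inverse (of_nat n) \<in> A_min s"
  by (simp add: of_nat_cst cst_in_A_min flip: cst_inverse)

lemma gauge_one_pair:
  "gauge_over cst (A_min s) deg nn (\<lambda>_ r. N_plus s q m r c)"
  "gauge_over cst (A_min s) deg nn (\<lambda>_ r. N_minus s q m r c)"
  by (rule gauge_overI[where lev = level_plus];
      (rule is_subring_A_min cst_in_A_min inverse_of_nat_in_A_min N_entries | erule N_plus_level))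
    (rule gauge_overI[where lev = level_minus];
      (rule is_subring_A_min cst_in_A_min inverse_of_nat_in_A_min N_entries | erule N_minus_level))

subsection \<open>Several pairs\<close>

lemma mconst_0 [simp]: "mconst 0 = 0" and mconst_1 [simp]: "mconst 1 = 1"
  and mconst_add: "mconst (z + w) = mconst z + mconst w"
  and mconst_mult: "mconst (z * w) = mconst z * mconst w"
  by (simp_all add: mconst_def single_add mult_single)

lemma mconst_sum: "mconst (sum g I) = (\<Sum>i\<in>I. mconst (g i))"
  by (induction I rule: infinite_finite_induct) (auto simp: mconst_add)

lemma mconst_eq_0_iff [simp]: "mconst z = 0 \<longleftrightarrow> z = 0"
  unfolding mconst_def by (metis lookup_single_eq lookup_zero single_zero)

lemma mvar_power: "mvar j ^ k = Poly_Mapping.single (Poly_Mapping.single j k) 1"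
  by (induction k) (simp_all add: mvar_def mult_single flip: single_add)

lemma at_var_altdef:
  fixes j :: 'n
  shows "at_var j p = (\<Sum>i\<le>degree p. Poly_Mapping.single (Poly_Mapping.single j i) (coeff p i))"
proof -
  have "degree (map_poly (mconst :: _ \<Rightarrow> 'n mpol) p) = degree p"
    by (rule degree_map_poly) simp
  then show ?thesis
    by (simp add: at_var_def poly_altdef coeff_map_poly mvar_power) (simp add: mconst_def mult_single)
qed

text \<open>The coefficients of p reappear at the pure powers of B_j, which is why
  \<open>at_var j\<close> is injective.\<close>

lemma lookup_at_var: "Poly_Mapping.lookup (at_var j p) (Poly_Mapping.single j k) = coeff p k"
proof -
  have "Poly_Mapping.lookup (at_var j p) (Poly_Mapping.single j k)
      = (\<Sum>i\<le>degree p. if i = k then coeff p k else 0)"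
    unfolding at_var_altdef lookup_sum lookup_single when_def
    by (intro sum.cong refl) (auto dest: arg_cong[of _ _ "\<lambda>t. Poly_Mapping.lookup t j"])
  then show ?thesis
    by (auto simp: coeff_eq_0)
qed

lemma map_poly_mconst_add: "map_poly mconst (p + q) = map_poly mconst p + map_poly mconst q"
  and map_poly_mconst_mult: "map_poly mconst (p * q) = map_poly mconst p * map_poly mconst q"
  by (rule poly_eqI; simp add: coeff_map_poly coeff_mult mconst_add mconst_mult mconst_sum)+

interpretation pair: poly_embedding "at_var j" for j :: "'n::linorder"
proof
  show "at_var j 1 = 1"
    by (simp add: at_var_def)
  show "at_var j (p + q) = at_var j p + at_var j q" "at_var j (p * q) = at_var j p * at_var j q" for p q
    by (simp_all add: at_var_def map_poly_mconst_add map_poly_mconst_mult)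
  show "p = 0" if "at_var j p = 0" for p
    using that lookup_at_var[of j p] by (intro poly_eqI) simp
qed

lemma iota_eq: "iota j = pair.ext j"
  by (simp add: iota_def pair.ext_def)

lemma iota_cst: "iota j (cst z) = mcst z"
  by (simp add: iota_eq cst_def mcst_def pair.ext_to_fract at_var_def map_poly_pCons)

text \<open>Factors can be regrouped by variable because every \<open>at_var j\<close> is
  multiplicative; a single generator is the family that is p at j and 1 elsewhere. This shape is
  already the absence of mixed denominators.\<close>

lemma S_pairs_eq:
  "(S_pairs s :: 'n::{finite,linorder} mpol set) = {\<Prod>j\<in>UNIV. at_var j (e j) | e. \<forall>j. e j \<in> S_min s}"
  (is "_ = ?P")
proof
  show "S_pairs s \<subseteq> ?P"
    unfolding S_pairs_def
  proof (rule hull_minimal)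
    show "(\<Union>j. at_var j ` S_min s) \<subseteq> ?P"
    proof clarify
      fix j :: 'n and p assume "p \<in> S_min s"
      then have 1: "\<forall>i. (if i = j then p else 1) \<in> S_min s"
        using mult_set_one[OF mult_set_S_min] by simp
      have 2: "(\<Prod>i\<in>UNIV. at_var i (if i = j then p else 1)) = at_var j p"
        by (simp add: if_distrib[of "at_var _"] pair.f_one cong: if_cong)
      show "\<exists>e. at_var j p = (\<Prod>i\<in>UNIV. at_var i (e i)) \<and> (\<forall>i. e i \<in> S_min s)"
        by (rule exI, rule conjI[OF 2[symmetric] 1])
    qed
    show "mult_set ?P"
      unfolding mult_set_def
    proof (intro conjI ballI)
      show "1 \<in> ?P"
        using mult_set_one[OF mult_set_S_min]
        by (auto simp: pair.f_one intro!: exI[of _ "\<lambda>_. 1"])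
      fix x y assume "x \<in> ?P" "y \<in> ?P"
      then obtain e e' where "x = (\<Prod>j\<in>UNIV. at_var j (e j))" "y = (\<Prod>j\<in>UNIV. at_var j (e' j))"
        "\<forall>j. e j \<in> S_min s" "\<forall>j. e' j \<in> S_min s"
        by blast
      then have "x * y = (\<Prod>j\<in>UNIV. at_var j (e j * e' j))" "\<forall>j. e j * e' j \<in> S_min s"
        by (auto simp: prod.distrib pair.f_mult intro: mult_set_mult[OF mult_set_S_min])
      then show "x * y \<in> ?P"
        by (intro CollectI exI[of _ "\<lambda>j. e j * e' j"] conjI)
    qed
  qed
  show "?P \<subseteq> S_pairs s"
  proof clarify
    fix e :: "'n \<Rightarrow> complex poly" assume "\<forall>j. e j \<in> S_min s"
    then have "at_var j (e j) \<in> S_pairs s" for j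
      unfolding S_pairs_def by (blast intro: hull_inc)
    then show "(\<Prod>j\<in>UNIV. at_var j (e j)) \<in> S_pairs s"
      unfolding S_pairs_def by (intro mult_set_prod[OF mult_set_hull])
  qed
qed

lemma mult_set_S_pairs: "mult_set (S_pairs s)"
  unfolding S_pairs_def by (rule mult_set_hull)

lemma S_min_nz: "p \<in> S_min s \<Longrightarrow> p \<noteq> 0"
  using zero_notin_S_min by metis

lemma zero_notin_S_pairs: "0 \<notin> (S_pairs s :: 'n::{finite,linorder} mpol set)"
  by (auto simp: S_pairs_eq pair.f_eq_0_iff dest: S_min_nz)

lemma is_subring_A_pairs: "is_subring (A_pairs s :: 'n::{finite,linorder} mpol fract set)"
  unfolding A_pairs_def by (rule is_subring_loc[OF mult_set_S_pairs zero_notin_S_pairs])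

lemma iota_in: "x \<in> A_min s \<Longrightarrow> iota j x \<in> A_pairs s"
  unfolding iota_eq A_min_def A_pairs_def
  by (rule pair.ext_loc) (auto simp: zero_notin_S_min S_pairs_def intro: hull_inc)

lemma mcst_in: "mcst z \<in> (A_pairs s :: 'n::{finite,linorder} mpol fract set)"
  using iota_in[OF cst_in_A_min, of undefined z] by (simp add: iota_cst)

text \<open>The map \<open>iota\<close> at an arbitrary index carries over the one-variable fact
  \<open>of_nat_cst\<close>.\<close>

lemma of_nat_mcst: "of_nat n = (mcst (of_nat n) :: 'a::linorder mpol fract)"
proof -
  have "iota j (of_nat n) = of_nat n" for j :: 'a
    by (induction n) (simp_all add: iota_eq pair.ext_add)
  moreover have "iota (undefined :: 'a) (of_nat n) = mcst (of_nat n)"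
    unfolding of_nat_cst by (rule iota_cst)
  ultimately show ?thesis
    by simp
qed

lemma mcst_mult: "mcst (z * w) = mcst z * mcst w"
  by (simp add: mcst_def mconst_mult)

lemma mcst_add: "mcst (z + w) = mcst z + mcst w"
  by (simp add: mcst_def mconst_add)

lemma mcst_0 [simp]: "mcst 0 = 0" and mcst_1 [simp]: "mcst 1 = 1"
  by (simp_all add: mcst_def)

lemma inverse_of_nat_in_A_pairs:
  "inverse (of_nat n) \<in> (A_pairs s :: 'n::{finite,linorder} mpol fract set)"
proof (cases "n = 0")
  case True
  then show ?thesis
    by (simp add: subring_zero[OF is_subring_A_pairs])
next
  case False
  then have "of_nat n * mcst (inverse (of_nat n)) = (1 :: 'n mpol fract)"
    by (simp add: of_nat_mcst flip: mcst_mult)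
  then have "inverse (of_nat n) = (mcst (inverse (of_nat n)) :: 'n mpol fract)"
    by (rule inverse_unique)
  then show ?thesis
    by (simp add: mcst_in)
qed

subsection \<open>Koszul signs\<close>

lemma hat_nth: "hat j F $ y $ x = (if \<forall>i. i \<noteq> j \<longrightarrow> y i = x i
     then (- 1) ^ card {i. i < j \<and> slot_odd (x i)} * iota j (F $ y j $ x j) else 0)"
  by (simp add: hat_def)

lemma hat_eq_0I: "F $ y j $ x j = 0 \<Longrightarrow> hat j F $ y $ x = 0"
    "i \<noteq> j \<Longrightarrow> y i \<noteq> x i \<Longrightarrow> hat j F $ y $ x = 0"
  by (auto simp: hat_nth iota_eq)

text \<open>Both counts share the odd slots other than j, and exactly one of them also includes j.
  With P meaning "before k" this is a Koszul sign change; with P constantly true it is the change of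
  total parity.\<close>

lemma odd_card_update:
  fixes x :: "'n::finite \<Rightarrow> slot"
  assumes "P j" "slot_odd u \<noteq> slot_odd (x j)"
  shows "odd (card {i. P i \<and> slot_odd ((x(j := u)) i)}) \<longleftrightarrow> even (card {i. P i \<and> slot_odd (x i)})"
proof -
  define A where "A = {i. P i \<and> i \<noteq> j \<and> slot_odd (x i)}"
  have "j \<notin> A"
    by (simp add: A_def)
  have "{i. P i \<and> slot_odd ((x(j := u)) i)} = (if slot_odd u then insert j A else A)"
    "{i. P i \<and> slot_odd (x i)} = (if slot_odd (x j) then insert j A else A)"
    using assms(1) by (auto simp: A_def)
  with \<open>j \<notin> A\<close> assms(2) show ?thesis
    by simp
qed

text \<open>Only one intermediate state contributes: it must agree with z off j and with x off
  k.\<close>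

lemma hat_mult_hat:
  assumes "j \<noteq> k"
  shows "(hat j F ** hat k G) $ z $ x = hat j F $ z $ (x(k := z k)) * hat k G $ (x(k := z k)) $ x"
proof -
  have "hat j F $ z $ w * hat k G $ w $ x = 0" if "w \<noteq> x(k := z k)" for w
  proof (rule ccontr)
    assume "\<not> ?thesis"
    then have "\<forall>i. i \<noteq> j \<longrightarrow> z i = w i" "\<forall>i. i \<noteq> k \<longrightarrow> w i = x i"
      by (auto simp: hat_nth split: if_splits)
    with assms have "w = x(k := z k)"
      by auto
    with that show False
      by simp
  qed
  then have "(\<Sum>w\<in>UNIV. hat j F $ z $ w * hat k G $ w $ x)
      = (\<Sum>w\<in>{x(k := z k)}. hat j F $ z $ w * hat k G $ w $ x)"
    by (intro sum.mono_neutral_right) auto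
  then show ?thesis
    by (simp add: matrix_mult_nth)
qed

text \<open>The sign of \<open>hat j\<close> counts slots before j and does not see a change at k.
  The sign of \<open>hat k\<close> counts slot j, whose parity F flips, so the two orders of
  composition differ by exactly one sign.\<close>

lemma hat_anticommute_less:
  fixes j k :: "'n::{finite,linorder}"
  assumes "j < k" "odd_map slot_odd F"
  shows "hat j F ** hat k G + hat k G ** hat j F = 0"
proof -
  have "(hat j F ** hat k G) $ z $ x + (hat k G ** hat j F) $ z $ x = 0" for z x
  proof (cases "(\<forall>i. i \<noteq> j \<longrightarrow> i \<noteq> k \<longrightarrow> z i = x i) \<and> F $ z j $ x j \<noteq> 0")
    case True
    then have c: "\<forall>i. i \<noteq> j \<longrightarrow> z i = (x(k := z k)) i" "\<forall>i. i \<noteq> k \<longrightarrow> (x(k := z k)) i = x i"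
      "\<forall>i. i \<noteq> k \<longrightarrow> z i = (x(j := z j)) i" "\<forall>i. i \<noteq> j \<longrightarrow> (x(j := z j)) i = x i"
      by auto
    have nth: "hat j F $ z $ (x(k := z k)) = (- 1) ^ card {i. i < j \<and> slot_odd ((x(k := z k)) i)}
          * iota j (F $ z j $ x j)"
      "hat k G $ (x(k := z k)) $ x = (- 1) ^ card {i. i < k \<and> slot_odd (x i)} * iota k (G $ z k $ x k)"
      "hat k G $ z $ (x(j := z j)) = (- 1) ^ card {i. i < k \<and> slot_odd ((x(j := z j)) i)}
          * iota k (G $ z k $ x k)"
      "hat j F $ (x(j := z j)) $ x = (- 1) ^ card {i. i < j \<and> slot_odd (x i)} * iota j (F $ z j $ x j)"
      unfolding hat_nth if_P[OF c(1)] if_P[OF c(2)] if_P[OF c(3)] if_P[OF c(4)]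
      using assms(1)[THEN less_imp_neq] by (simp_all add: eq_commute[of k j])
    have "{i. i < j \<and> slot_odd ((x(k := z k)) i)} = {i. i < j \<and> slot_odd (x i)}"
      using assms(1) by auto
    moreover have "slot_odd (z j) \<noteq> slot_odd (x j)"
      using True assms(2) by (auto simp: odd_map_def)
    then have "(- 1 :: 'n mpol fract) ^ card {i. i < k \<and> slot_odd ((x(j := z j)) i)}
        = - ((- 1) ^ card {i. i < k \<and> slot_odd (x i)})"
      using odd_card_update[of "\<lambda>i. i < k" j "z j" x] assms(1)
      by (auto simp: minus_one_power_iff simp del: fun_upd_apply)
    ultimately show ?thesis
      using assms(1) by (simp add: hat_mult_hat nth del: fun_upd_apply)
  next
    case False
    then consider "F $ z j $ x j = 0" | i where "i \<noteq> j" "i \<noteq> k" "z i \<noteq> x i"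
      by blast
    \<comment> \<open>A vanishing entry of F kills the \<open>hat j\<close> factor in both products;
      a difference at a position that neither map can change kills the left factor of both.\<close>
    then have "hat j F $ z $ (x(k := z k)) = 0 \<and> hat j F $ (x(j := z j)) $ x = 0
       \<or> hat j F $ z $ (x(k := z k)) = 0 \<and> hat k G $ z $ (x(j := z j)) = 0"
    proof cases
      case 1
      then show ?thesis
        using less_imp_neq[OF assms(1)] by (intro disjI1 conjI hat_eq_0I(1)) simp_all
    next
      case (2 i)
      then show ?thesis
        by (intro disjI2 conjI hat_eq_0I(2)[of i]) simp_all
    qed
    then show ?thesis
      using assms(1) by (auto simp: hat_mult_hat simp del: fun_upd_apply)
  qed
  then show ?thesis
    by (simp add: vec_eq_iff)
qed

lemma hat_anticommute:
  assumes "j \<noteq> k" "odd_map slot_odd F" "odd_map slot_odd G"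
  shows "hat j F ** hat k G + hat k G ** hat j F = 0"
  using assms hat_anticommute_less[of j k F G] hat_anticommute_less[of k j G F]
  by (auto simp: neq_iff add.commute)

text \<open>Slot j is not among the slots before j, so both factors carry the same sign, which
  squares to 1. What remains is the one-pair product, summed over the intermediate value of slot
  j.\<close>

lemma hat_mult_same:
  "(hat j F ** hat j G) $ z $ x = (if \<forall>i. i \<noteq> j \<longrightarrow> z i = x i then iota j ((F ** G) $ z j $ x j) else 0)"
proof -
  define C where "C \<longleftrightarrow> (\<forall>i. i \<noteq> j \<longrightarrow> z i = x i)"
  have sign: "{i. i < j \<and> slot_odd ((x(j := v)) i)} = {i. i < j \<and> slot_odd (x i)}" for v
    by auto
  have *: "hat j F $ z $ (x(j := v)) * hat j G $ (x(j := v)) $ x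
      = (if C then iota j (F $ z j $ v * G $ v $ x j) else 0)" for v
  proof -
    have c: "(\<forall>i. i \<noteq> j \<longrightarrow> z i = (x(j := v)) i) \<longleftrightarrow> C" "\<forall>i. i \<noteq> j \<longrightarrow> (x(j := v)) i = x i"
      by (auto simp: C_def)
    show ?thesis
      unfolding hat_nth sign c(1) if_P[OF c(2)]
      by (simp add: iota_eq pair.ext_mult flip: power_mult_distrib)
  qed
  have "hat j F $ z $ w * hat j G $ w $ x = 0" if "w \<notin> range (\<lambda>v. x(j := v))" for w
  proof (rule ccontr)
    assume "\<not> ?thesis"
    then have "\<forall>i. i \<noteq> j \<longrightarrow> w i = x i"
      by (auto simp: hat_nth split: if_splits)
    then have "w = x(j := w j)"
      by auto
    with that show False
      by blast
  qed
  then have "(hat j F ** hat j G) $ z $ x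
      = (\<Sum>w\<in>range (\<lambda>v. x(j := v)). hat j F $ z $ w * hat j G $ w $ x)"
    unfolding matrix_mult_nth by (intro sum.mono_neutral_right) auto
  also have "\<dots> = (\<Sum>v\<in>UNIV. hat j F $ z $ (x(j := v)) * hat j G $ (x(j := v)) $ x)"
    by (subst sum.reindex) (auto intro!: injI dest: fun_cong[of _ _ j] simp del: fun_upd_apply simp: fun_upd_eqD)
  also have "\<dots> = (if C then iota j ((F ** G) $ z j $ x j) else 0)"
    unfolding * by (simp add: iota_eq matrix_mult_nth pair.ext_sum)
  finally show ?thesis
    unfolding C_def .
qed

lemma hat_homotopy:
  assumes "F ** G + G ** F = mat 1"
  shows "hat j F ** hat j G + hat j G ** hat j F = mat 1"
proof -
  have "(hat j F ** hat j G) $ z $ x + (hat j G ** hat j F) $ z $ x = mat 1 $ z $ x" for z x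
  proof -
    have "(F ** G) $ z j $ x j + (G ** F) $ z j $ x j = mat 1 $ z j $ x j"
      using assms by (metis vector_add_component)
    then have "iota j ((F ** G) $ z j $ x j) + iota j ((G ** F) $ z j $ x j) = (if z j = x j then 1 else 0)"
      by (simp add: iota_eq mat_nth flip: pair.ext_add)
    moreover have "z = x \<longleftrightarrow> (\<forall>i. i \<noteq> j \<longrightarrow> z i = x i) \<and> z j = x j"
      by auto
    ultimately show ?thesis
      by (auto simp: hat_mult_same mat_nth)
  qed
  then show ?thesis
    by (simp add: vec_eq_iff)
qed

lemma sum_matrix_mult_sum:
  fixes F G :: "'i \<Rightarrow> 'k::comm_ring_1^'x::finite^'x"
  shows "((\<Sum>j\<in>J. F j) ** (\<Sum>k\<in>K. G k)) $ z $ x = (\<Sum>j\<in>J. \<Sum>k\<in>K. (F j ** G k) $ z $ x)"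
proof -
  have "((\<Sum>j\<in>J. F j) ** (\<Sum>k\<in>K. G k)) $ z $ x
      = (\<Sum>w\<in>UNIV. \<Sum>j\<in>J. \<Sum>k\<in>K. F j $ z $ w * G k $ w $ x)"
    by (simp add: matrix_mult_nth sum_product)
  also have "\<dots> = (\<Sum>j\<in>J. \<Sum>w\<in>UNIV. \<Sum>k\<in>K. F j $ z $ w * G k $ w $ x)"
    by (rule sum.swap)
  also have "\<dots> = (\<Sum>j\<in>J. \<Sum>k\<in>K. \<Sum>w\<in>UNIV. F j $ z $ w * G k $ w $ x)"
    by (intro sum.cong refl sum.swap)
  finally show ?thesis
    by (simp add: matrix_mult_nth)
qed

lemma mat_mult_nth: "(mat a ** F) $ z $ x = a * F $ z $ x"
proof -
  have "(mat a ** F) $ z $ x = (\<Sum>w\<in>UNIV. if w = z then a * F $ z $ x else 0)"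
    unfolding matrix_mult_nth by (intro sum.cong) (auto simp: mat_nth)
  then show ?thesis
    by simp
qed

text \<open>The homotopies of the \<open>n\<close> factors contribute \<open>n\<close> times the identity, and all mixed terms cancel.\<close>

lemma pairs_homotopy:
  fixes c :: "'n::{finite,linorder} \<Rightarrow> int"
  assumes odd: "\<And>c. odd_map slot_odd (Q c)" "\<And>c. odd_map slot_odd (h c)"
    and Qh: "\<And>c. Q c ** h c + h c ** Q c = mat 1"
  shows "Q_pairs Q c ** h_pairs h c + h_pairs h c ** Q_pairs Q c = mat 1"
proof -
  define H where "H = (\<Sum>j\<in>UNIV. hat j (h (c j)))"
  define a :: "'n mpol fract" where "a = mcst (1 / of_nat CARD('n))"
  have h_pairs: "h_pairs h c = mat a ** H"
    by (simp add: h_pairs_def H_def a_def)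
  have "(Q_pairs Q c ** h_pairs h c + h_pairs h c ** Q_pairs Q c) $ z $ x = mat 1 $ z $ x" for z x
  proof -
    have "(Q_pairs Q c ** h_pairs h c) $ z $ x = a * (Q_pairs Q c ** H) $ z $ x"
      unfolding h_pairs matrix_mult_nth[of "Q_pairs Q c"] mat_mult_nth
      by (simp add: sum_distrib_left ac_simps)
    moreover have "(h_pairs h c ** Q_pairs Q c) $ z $ x = a * (H ** Q_pairs Q c) $ z $ x"
      unfolding h_pairs matrix_mult_nth[of "mat a ** H"] mat_mult_nth
      by (simp add: matrix_mult_nth sum_distrib_left ac_simps)
    moreover have "(Q_pairs Q c ** H) $ z $ x + (H ** Q_pairs Q c) $ z $ x
      = (\<Sum>j\<in>UNIV. \<Sum>k\<in>UNIV. (hat j (Q (c j)) ** hat k (h (c k)) + hat k (h (c k)) ** hat j (Q (c j))) $ z $ x)"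
    proof -
      have "(H ** Q_pairs Q c) $ z $ x
          = (\<Sum>j\<in>UNIV. \<Sum>k\<in>UNIV. (hat k (h (c k)) ** hat j (Q (c j))) $ z $ x)"
        unfolding H_def Q_pairs_def sum_matrix_mult_sum by (rule sum.swap)
      then show ?thesis
        by (simp add: H_def Q_pairs_def sum_matrix_mult_sum sum.distrib)
    qed
    moreover have "(hat j (Q (c j)) ** hat k (h (c k)) + hat k (h (c k)) ** hat j (Q (c j))) $ z $ x
        = (if k = j then mat 1 $ z $ x else 0)" for j k
      using hat_homotopy[OF Qh, of j "c j"] hat_anticommute[OF _ odd, of j k "c j" "c k"]
      by (auto simp del: vector_add_component)
    ultimately have "(Q_pairs Q c ** h_pairs h c + h_pairs h c ** Q_pairs Q c) $ z $ x
        = (a * of_nat CARD('n)) * mat 1 $ z $ x"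
      by (simp flip: distrib_left)
    also have "a * of_nat CARD('n) = 1"
      by (simp add: a_def of_nat_mcst flip: mcst_mult)
    finally show ?thesis
      by simp
  qed
  then show ?thesis
    unfolding vec_eq_iff by blast
qed

lemma hat_entries:
  "entries_in (A_min s) F \<Longrightarrow> entries_in (A_pairs s) (hat j F)"
  by (auto simp: entries_in_def hat_nth intro!: subring_mult[OF is_subring_A_pairs]
      subring_zero[OF is_subring_A_pairs] subring_minus_one_power[OF is_subring_A_pairs] iota_in)

lemma Q_pairs_entries:
  "(\<And>c. entries_in (A_min s) (Q c)) \<Longrightarrow> entries_in (A_pairs s) (Q_pairs Q c)"
  unfolding Q_pairs_def by (intro entries_in_sum[OF is_subring_A_pairs] hat_entries)

lemma h_pairs_entries:
  "(\<And>c. entries_in (A_min s) (h c)) \<Longrightarrow> entries_in (A_pairs s) (h_pairs h c)"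
  unfolding h_pairs_def
  by (intro entries_in_mult[OF is_subring_A_pairs] entries_in_mat[OF is_subring_A_pairs] mcst_in
      entries_in_sum[OF is_subring_A_pairs] hat_entries)

lemma odd_map_h_pairs:
  assumes odd: "\<And>c. odd_map slot_odd (h c)"
  shows "odd_map tensor_odd (h_pairs h c)"
  unfolding odd_map_def
proof (intro allI impI)
  fix y x assume "h_pairs h c $ y $ x \<noteq> 0"
  then have "(\<Sum>j\<in>UNIV. hat j (h (c j)) $ y $ x) \<noteq> 0"
    by (simp add: h_pairs_def mat_mult_nth)
  then obtain j where "hat j (h (c j)) $ y $ x \<noteq> 0"
    by (meson sum.neutral)
  then have *: "\<forall>i. i \<noteq> j \<longrightarrow> y i = x i" "h (c j) $ y j $ x j \<noteq> 0"
    by (auto simp: hat_nth iota_eq split: if_splits)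
  then have "y = x(j := y j)" "slot_odd (y j) \<noteq> slot_odd (x j)"
    using odd by (auto simp: odd_map_def)
  then show "tensor_odd y \<noteq> tensor_odd x"
    using odd_card_update[of "\<lambda>_. True" j "y j" x] by (simp add: tensor_odd_def)
qed

lemma contracting_pairs:
  "contracting tensor_odd (A_pairs s) (Q_pairs (Q_plus s) c) (h_pairs (h_plus s) c)"
  "contracting tensor_odd (A_pairs s) (Q_pairs (Q_minus s) c) (h_pairs (h_minus s) c)"
  unfolding contracting_def
  by (intro conjI h_pairs_entries h_entries odd_map_h_pairs h_odd pairs_homotopy Q_odd Q_h_plus Q_h_minus)+

text \<open>Slot j alone changes, so a rise there raises the total. The summed level thus makes all
  the maps \<open>hat i\<close> raise one common grading.\<close>

lemma hat_level:
  fixes x y :: "'n::{finite,linorder} \<Rightarrow> slot"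
  assumes "hat j F $ y $ x \<noteq> 0" and lev: "F $ y j $ x j \<noteq> 0 \<Longrightarrow> (lev (x j) :: nat) < lev (y j)"
  shows "(\<Sum>i\<in>UNIV. lev (x i)) < (\<Sum>i\<in>UNIV. lev (y i))"
proof (rule sum_strict_mono_ex1)
  have *: "\<forall>i. i \<noteq> j \<longrightarrow> y i = x i" "F $ y j $ x j \<noteq> 0"
    using assms(1) by (auto simp: hat_nth iota_eq split: if_splits)
  show "\<forall>i\<in>UNIV. lev (x i) \<le> lev (y i)"
    using * lev by (metis order.refl less_imp_le)
  show "\<exists>i\<in>UNIV. lev (x i) < lev (y i)"
    using * lev by blast
qed simp

lemma gauge_pairs:
  fixes c :: "'n::{finite,linorder} \<Rightarrow> int"
  shows "gauge_over mcst (A_pairs s) deg nn (\<lambda>i r. hat i (N_plus s q m r (c i)))"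
    "gauge_over mcst (A_pairs s) deg nn (\<lambda>i r. hat i (N_minus s q m r (c i)))"
  by (rule gauge_overI[where lev = "\<lambda>x. \<Sum>i\<in>UNIV. level_plus (x i)"];
      (rule is_subring_A_pairs mcst_in inverse_of_nat_in_A_pairs hat_entries N_entries
        | erule hat_level N_plus_level)+)
    (rule gauge_overI[where lev = "\<lambda>x. \<Sum>i\<in>UNIV. level_minus (x i)"];
      (rule is_subring_A_pairs mcst_in inverse_of_nat_in_A_pairs hat_entries N_entries
        | erule hat_level N_minus_level)+)

subsection \<open>Minimality\<close>

context poly_embedding
begin

text \<open>The inverses of the coefficients \<open>beta\<close> and \<open>alpha\<close> yield the orbit of \<open>d_pol\<close>; this absorbs the
  denominators that \<open>pi_plus\<close> and \<open>pi_minus\<close> carry on half of the charges.\<close>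

lemma S_min_saturated:
  assumes T: "mult_set T" "0 \<notin> T"
    and units: "\<And>c. \<exists>y\<in>loc T. ext (pi_plus s c) * y = 1" "\<And>c. \<exists>y\<in>loc T. ext (pi_minus s c) * y = 1"
      "\<And>c. \<exists>y\<in>loc T. ext (beta c) * y = 1" "\<And>c. \<exists>y\<in>loc T. ext (alpha c) * y = 1"
    and "p \<in> S_min s"
  shows "f p \<in> saturation T"
proof -
  note R = is_subring_loc[OF T]
  \<comment> \<open>\<open>beta k\<close> supplies the shifts k \<ge> 1, and
    \<open>alpha (k - 1)\<close> the shifts k \<le> 0.\<close>
  have d: "\<exists>y\<in>loc T. to_fract (f (shift k d_pol)) * y = 1" for k
    using units(3)[of k] units(4)[of "k - 1"]
    by (cases "k \<ge> 1") (simp_all add: beta_eq alpha_eq ext_to_fract)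
  have d_inv: "inverse (to_fract (f (shift k d_pol))) \<in> loc T" for k
    using d[of k] by (metis inverse_unique)
  have l: "f (shift k l) \<in> saturation T"
    if y: "y \<in> loc T" "ext (cst (1 / 4) * to_fract (shift k l)
        * (if b then 1 else inverse (to_fract (shift k' d_pol)))) * y = 1" for k k' l b y
  proof -
    \<comment> \<open>Multiplying the given inverse back by the scalar and by the possible inverse
      of d leaves an inverse of the bare linear factor.\<close>
    define w where "w = ext (cst (1 / 4)) * (if b then 1 else inverse (to_fract (f (shift k' d_pol)))) * y"
    have "ext (cst (1 / 4)) \<in> loc T"
      unfolding cst_def ext_to_fract by (rule to_fract_in_loc[OF T(1)])
    then have "w \<in> loc T"
      using y(1) d_inv by (auto simp: w_def intro!: subring_mult[OF R] subring_one[OF R])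
    moreover have "to_fract (f (shift k l)) * w = 1"
      using y(2) by (simp add: w_def ext_mult ext_to_fract ext_inverse ac_simps split: if_splits)
    ultimately show ?thesis
      by (rule saturationI_unit[OF T(1)])
  qed
  have "S_min s \<subseteq> {p. f p \<in> saturation T}"
  proof (rule S_min_subsetI)
    show "mult_set {p. f p \<in> saturation T}"
      using mult_set_saturation[OF T(1)] by (auto simp: mult_set_def f_one f_mult)
    fix k
    show "shift k d_pol \<in> {p. f p \<in> saturation T}"
      using d[of k] saturationI_unit[OF T(1)] by blast
    show "shift k (l_plus s) \<in> {p. f p \<in> saturation T}"
      using units(1)[of k] l unfolding pi_plus_eq by blast
    show "shift k (l_minus s) \<in> {p. f p \<in> saturation T}"
      using units(2)[of k] l unfolding pi_minus_eq by blast
  qed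
  with assms show ?thesis
    by auto
qed

definition ext_mat :: "complex poly fract^slot^slot \<Rightarrow> 'r fract^slot^slot" where
  "ext_mat F = (\<chi> y x. ext (F $ y $ x))"

text \<open>Q kills E0 and reaches it from one slot only; nothing is mapped into E2, and E2 is
  mapped to one slot only. So the entries of the anticommutator at (E0, E0) and (E2, E2) are single
  products: the former inverts pi, the latter \<open>beta\<close> or \<open>alpha\<close> up to the
  scalar 1/(2i).\<close>

lemma contraction_units:
  assumes R: "is_subring R" and cst: "\<And>z. ext (cst z) \<in> R"
    and "contractible_over slot_odd R (ext_mat (Q_plus s c))"
      "contractible_over slot_odd R (ext_mat (Q_minus s c))"
  shows "\<exists>y\<in>R. ext (pi_plus s c) * y = 1" "\<exists>y\<in>R. ext (beta c) * y = 1"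
    "\<exists>y\<in>R. ext (pi_minus s c) * y = 1" "\<exists>y\<in>R. ext (alpha c) * y = 1"
proof -
  obtain h where h: "entries_in R h" "ext_mat (Q_plus s c) ** h + h ** ext_mat (Q_plus s c) = mat 1"
    using assms(3) by (auto simp: contractible_over_def contracting_def)
  have "(ext_mat (Q_plus s c) ** h + h ** ext_mat (Q_plus s c)) $ x $ x = 1" for x
    by (simp add: h mat_nth)
  from this[of E0] this[of E2]
  have *: "ext (pi_plus s c) * h $ Eth $ E0 = 1" "h $ E2 $ Ebar * ext (cst (1 / (2 * \<i>)) * beta c) = 1"
    by (simp_all add: ext_mat_def Q_plus_def arrow_nth matrix_mult_nth sum_slot)
  then show "\<exists>y\<in>R. ext (pi_plus s c) * y = 1"
    using h(1) by (auto simp: entries_in_def)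
  have "ext (beta c) * (ext (cst (1 / (2 * \<i>))) * h $ E2 $ Ebar) = 1"
    using *(2) by (simp only: ext_mult ac_simps)
  then show "\<exists>y\<in>R. ext (beta c) * y = 1"
    using h(1) cst subring_mult[OF R] by (auto simp: entries_in_def)
  obtain h where h: "entries_in R h" "ext_mat (Q_minus s c) ** h + h ** ext_mat (Q_minus s c) = mat 1"
    using assms(4) by (auto simp: contractible_over_def contracting_def)
  have "(ext_mat (Q_minus s c) ** h + h ** ext_mat (Q_minus s c)) $ x $ x = 1" for x
    by (simp add: h mat_nth)
  from this[of E0] this[of E2]
  have *: "ext (pi_minus s c) * h $ Ebar $ E0 = 1" "h $ E2 $ Eth * ext (cst (1 / (2 * \<i>)) * alpha c) = 1"
    by (simp_all add: ext_mat_def Q_minus_def arrow_nth matrix_mult_nth sum_slot)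
  then show "\<exists>y\<in>R. ext (pi_minus s c) * y = 1"
    using h(1) by (auto simp: entries_in_def)
  have "ext (alpha c) * (ext (cst (1 / (2 * \<i>))) * h $ E2 $ Eth) = 1"
    using *(2) by (simp only: ext_mult ac_simps)
  then show "\<exists>y\<in>R. ext (alpha c) * y = 1"
    using h(1) cst subring_mult[OF R] by (auto simp: entries_in_def)
qed

lemma minimal_for_contractibility:
  assumes T: "mult_set T"
    and "\<And>c. contractible_over slot_odd (loc T) (ext_mat (Q_plus s c))"
      "\<And>c. contractible_over slot_odd (loc T) (ext_mat (Q_minus s c))"
    and p: "p \<in> S_min s"
  shows "f p \<in> saturation T"
proof (cases "0 \<in> T")
  case False
  have "ext (cst z) \<in> loc T" for z
    unfolding cst_def ext_to_fract by (rule to_fract_in_loc[OF T])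
  from contraction_units[OF is_subring_loc[OF T False] this assms(2,3)]
  show ?thesis
    using S_min_saturated[OF T False _ _ _ _ p] by blast
qed (simp add: saturation_UNIV)

end

section \<open>Minimality for one pair and for several pairs\<close>

lemma minimal_one_pair:
  assumes "mult_set T" "\<And>c. contractible_over slot_odd (loc T) (Q_plus s c)"
      "\<And>c. contractible_over slot_odd (loc T) (Q_minus s c)"
  shows "S_min s \<subseteq> saturation T"
proof -
  have "ident.ext_mat F = F" for F
    by (simp add: ident.ext_mat_def ext_ident vec_eq_iff)
  then show ?thesis
    using ident.minimal_for_contractibility[OF assms(1), of s] assms(2,3) by auto
qed

lemma S_pairs_subsetI:
  assumes "mult_set X" "\<And>j p. p \<in> S_min s \<Longrightarrow> at_var j p \<in> X"
  shows "S_pairs s \<subseteq> X"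
  unfolding S_pairs_def using assms by (intro hull_minimal) auto

lemma minimal_pairs_contractible:
  fixes T :: "'n::{finite,linorder} mpol set"
  assumes "mult_set T" "\<And>j c. contractible_over slot_odd (loc T) (iota_map j (Q_plus s c))"
      "\<And>j c. contractible_over slot_odd (loc T) (iota_map j (Q_minus s c))"
  shows "S_pairs s \<subseteq> saturation T"
proof (rule S_pairs_subsetI)
  have "iota_map j = pair.ext_mat j" for j :: 'n
    by (simp add: fun_eq_iff iota_map_def pair.ext_mat_def iota_eq)
  then show "at_var j p \<in> saturation T" if "p \<in> S_min s" for j p
    using pair.minimal_for_contractibility[OF assms(1) _ _ that] assms(2,3) by simp
qed (rule mult_set_saturation[OF assms(1)])

text \<open>On the vacuum \<open>E0\<close> of all other factors the homotopy acts without a sign.\<close>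

lemma h_pairs_entry:
  fixes j :: "'n::{finite,linorder}"
  assumes "u \<noteq> v"
  defines "e w \<equiv> (\<lambda>_. E0)(j := w)"
  shows "h_pairs h c $ e v $ e u = mcst (1 / of_nat CARD('n)) * iota j (h (c j) $ v $ u)"
proof -
  have "hat i (h (c i)) $ e v $ e u = (if i = j then iota j (h (c j) $ v $ u) else 0)" for i
  proof (cases "i = j")
    case True
    have sign: "{i. i < j \<and> slot_odd (e u i)} = {}"
      by (auto simp: e_def slot_odd_def)
    have e: "\<forall>i. i \<noteq> j \<longrightarrow> e v i = e u i" "e v j = v" "e u j = u"
      by (simp_all add: e_def)
    show ?thesis
      unfolding True hat_nth if_P[OF e(1)] e(2,3) sign by simp
  next
    case False
    with assms show ?thesis
      by (simp add: hat_eq_0I(2)[of j])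
  qed
  then show ?thesis
    by (simp add: h_pairs_def mat_mult_nth)
qed

text \<open>Entries between states that are E0 away from j display the inverses of all one-pair
  coefficients, up to the invertible scalars 1/n and 2i.\<close>

lemma minimal_pairs_homotopies:
  fixes T :: "'n::{finite,linorder} mpol set"
  assumes T: "mult_set T"
    and h: "\<And>c::'n \<Rightarrow> int. entries_in (loc T) (h_pairs (h_plus s) c)"
      "\<And>c::'n \<Rightarrow> int. entries_in (loc T) (h_pairs (h_minus s) c)"
  shows "S_pairs s \<subseteq> saturation T"
proof (rule S_pairs_subsetI)
  fix j :: 'n and p assume p: "p \<in> S_min s"
  show "at_var j p \<in> saturation T"
  proof (cases "0 \<in> T")
    case False
    note R = is_subring_loc[OF T False]
    have mcst: "mcst z \<in> loc T" for z
      unfolding mcst_def by (rule to_fract_in_loc[OF T])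
    have entry: "iota j (h c $ v $ u) \<in> loc T"
      if "u \<noteq> v" "\<And>c::'n \<Rightarrow> int. entries_in (loc T) (h_pairs h c)"
      for h :: "int \<Rightarrow> complex poly fract^slot^slot" and c u v
    proof -
      \<comment> \<open>The constant charge family puts the wanted charge c on factor j.\<close>
      have "mcst (1 / of_nat CARD('n)) * iota j (h c $ v $ u) \<in> loc T"
        using that(2)[of "\<lambda>_. c"] h_pairs_entry[OF that(1), where c = "\<lambda>_. c" and h = h and j = j]
        by (metis entries_in_def)
      from subring_mult[OF R mcst[of "of_nat CARD('n)"] this] show ?thesis
        by (simp flip: mcst_mult mult.assoc)
    qed
    have unit: "\<exists>y\<in>loc T. iota j x * y = 1" if "x \<noteq> 0" "iota j (inverse x) \<in> loc T" for x
      using that by (intro bexI[of _ "iota j (inverse x)"])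
        (simp_all add: iota_eq flip: pair.ext_mult)
    have unit': "iota j (inverse x) \<in> loc T" if "iota j (cst (2 * \<i>) * inverse x) \<in> loc T" for x
    proof -
      have "mcst (1 / (2 * \<i>)) * iota j (cst (2 * \<i>) * inverse x) \<in> loc T"
        by (rule subring_mult[OF R mcst that])
      moreover have "cst (1 / (2 * \<i>)) * (cst (2 * \<i>) * inverse x) = inverse x"
        by (simp flip: cst_mult mult.assoc)
      then have "mcst (1 / (2 * \<i>)) * iota j (cst (2 * \<i>) * inverse x) = iota j (inverse x)"
        unfolding iota_cst[of j, symmetric] iota_eq pair.ext_mult[symmetric] by (simp only:)
      ultimately show ?thesis
        by simp
    qed
    have inv: "iota j (inverse (pi_plus s c)) \<in> loc T" "iota j (inverse (pi_minus s c)) \<in> loc T"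
      "iota j (cst (2 * \<i>) * inverse (beta c)) \<in> loc T" "iota j (cst (2 * \<i>) * inverse (alpha c)) \<in> loc T"
      for c
      using entry[OF _ h(1), of E0 Eth c] entry[OF _ h(2), of E0 Ebar c]
        entry[OF _ h(1), of Ebar E2 c] entry[OF _ h(2), of Eth E2 c]
      by (simp_all add: h_plus_def h_minus_def arrow_nth)
    note units = unit[OF pi_plus_nz inv(1)] unit[OF pi_minus_nz inv(2)]
      unit[OF beta_nz unit'[OF inv(3)]] unit[OF alpha_nz unit'[OF inv(4)]]
    show ?thesis
      by (rule pair.S_min_saturated[OF T False units[unfolded iota_eq] p])
  qed (simp add: saturation_UNIV)
qed (rule mult_set_saturation[OF T])

subsection \<open>Coalescence of orbits\<close>

lemma shift_shift: "shift k (shift l p) = shift (k + l) p"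
proof -
  have "shift k (shift l p) = p \<circ>\<^sub>p ([:2 * \<i> * of_int l, 1:] \<circ>\<^sub>p [:2 * \<i> * of_int k, 1:])"
    by (simp add: shift_def pcompose_assoc)
  also have "[:2 * \<i> * of_int l, 1:] \<circ>\<^sub>p [:2 * \<i> * of_int k, 1:] = [:2 * \<i> * of_int (k + l), 1:]"
    by (simp add: pcompose_pCons algebra_simps)
  finally show ?thesis
    by (simp add: shift_def)
qed

lemma shift_smult: "shift k (smult z p) = smult z (shift k p)"
  by (simp add: shift_def pcompose_smult)

lemma shift_0: "shift 0 p = p"
  by (simp add: shift_def)

text \<open>The families are orbits of the group of shifts and nonzero scalings, so they agree once
  a representative of one lies in the other.\<close>

lemma orbit_family_eq_iff: "orbit_family p = orbit_family q \<longleftrightarrow> (\<exists>z k. z \<noteq> 0 \<and> q = smult z (shift k p))"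
proof
  assume "orbit_family p = orbit_family q"
  moreover have "q \<in> orbit_family q"
    unfolding orbit_family_def by (intro CollectI exI[of _ 1] exI[of _ 0]) (simp add: shift_0)
  ultimately have "q \<in> orbit_family p"
    by simp
  then show "\<exists>z k. z \<noteq> 0 \<and> q = smult z (shift k p)"
    by (auto simp: orbit_family_def)
next
  assume "\<exists>z k. z \<noteq> 0 \<and> q = smult z (shift k p)"
  then obtain z k where q: "z \<noteq> 0" "q = smult z (shift k p)"
    by blast
  show "orbit_family p = orbit_family q"
  proof (intro equalityI subsetI)
    fix x assume "x \<in> orbit_family p"
    then obtain w l where "w \<noteq> 0" "x = smult w (shift l p)"
      by (auto simp: orbit_family_def)
    with q have "x = smult (w / z) (shift (l - k) q)" "w / z \<noteq> 0"
      by (simp_all add: shift_smult shift_shift)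
    then show "x \<in> orbit_family q"
      unfolding orbit_family_def by blast
  next
    fix x assume "x \<in> orbit_family q"
    then obtain w l where "w \<noteq> 0" "x = smult w (shift l q)"
      by (auto simp: orbit_family_def)
    with q have "x = smult (w * z) (shift (l + k) p)" "w * z \<noteq> 0"
      by (simp_all add: shift_smult shift_shift)
    then show "x \<in> orbit_family p"
      unfolding orbit_family_def by blast
  qed
qed

text \<open>The leading coefficients force z = -2i; the constant terms then give s = -2i (2k-1) i =
  4(k-1) + 2.\<close>

lemma coalescence_d_plus: "orbit_family d_pol = orbit_family (l_plus s) \<longleftrightarrow> (\<exists>k::int. s = of_int (4 * k + 2))"
proof -
  have "(\<exists>z k. z \<noteq> 0 \<and> l_plus s = smult z (shift k d_pol)) \<longleftrightarrow> (\<exists>k::int. s = of_int (4 * (k - 1) + 2))"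
    by (auto simp: l_plus_def shift_d_pol algebra_simps)
  also have "\<dots> \<longleftrightarrow> (\<exists>k::int. s = of_int (4 * k + 2))"
    by (metis add_diff_cancel_right')
  finally show ?thesis
    by (simp only: orbit_family_eq_iff)
qed

text \<open>Here z = 2i, and s = 2i (2k-1) i = 4(-k) + 2.\<close>

lemma coalescence_d_minus: "orbit_family d_pol = orbit_family (l_minus s) \<longleftrightarrow> (\<exists>k::int. s = of_int (4 * k + 2))"
proof -
  have "(\<exists>z k. z \<noteq> 0 \<and> l_minus s = smult z (shift k d_pol)) \<longleftrightarrow> (\<exists>k::int. s = of_int (4 * (- k) + 2))"
    by (auto simp: l_minus_def shift_d_pol algebra_simps)
  also have "\<dots> \<longleftrightarrow> (\<exists>k::int. s = of_int (4 * k + 2))"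
    by (metis minus_minus)
  finally show ?thesis
    by (simp only: orbit_family_eq_iff)
qed

text \<open>The leading coefficients force z = -1, so s = -(s + 4k), that is s = -2k.\<close>

lemma coalescence_plus_minus: "orbit_family (l_plus s) = orbit_family (l_minus s) \<longleftrightarrow> (\<exists>k::int. s = of_int (2 * k))"
proof -
  have "(\<exists>z k. z \<noteq> 0 \<and> l_minus s = smult z (shift k (l_plus s))) \<longleftrightarrow> (\<exists>k::int. s = of_int (2 * (- k)))"
  proof
    assume "\<exists>z k. z \<noteq> 0 \<and> l_minus s = smult z (shift k (l_plus s))"
    then obtain z k where "s = z * (s + of_int (4 * k))" "2 * \<i> = z * (- 2 * \<i>)"
      by (auto simp: l_minus_def shift_l_plus)
    moreover have "2 * \<i> = - 1 * (- 2 * \<i>)"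
      by simp
    with \<open>2 * \<i> = z * (- 2 * \<i>)\<close> have "z * (- 2 * \<i>) = - 1 * (- 2 * \<i>)"
      by (rule trans[OF sym])
    then have "z = - 1"
      by (rule mult_right_cancel[THEN iffD1, rotated]) simp
    ultimately have "s = - (s + of_int (4 * k))"
      by simp
    then have "s = of_int (2 * (- k))"
      unfolding of_int_mult of_int_minus of_int_numeral by algebra
    then show "\<exists>k::int. s = of_int (2 * (- k))"
      by blast
  next
    assume "\<exists>k::int. s = of_int (2 * (- k))"
    then obtain k :: int where "s = of_int (2 * (- k))"
      by blast
    then have "l_minus s = smult (- 1) (shift k (l_plus s))"
      by (simp add: l_minus_def shift_l_plus)
    then show "\<exists>z k. z \<noteq> 0 \<and> l_minus s = smult z (shift k (l_plus s))"
      by (metis neg_equal_0_iff_equal one_neq_zero)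
  qed
  also have "\<dots> \<longleftrightarrow> (\<exists>k::int. s = of_int (2 * k))"
    by (metis minus_minus)
  finally show ?thesis
    by (simp only: orbit_family_eq_iff)
qed

subsection \<open>The tensor product of the one-pair localizations\<close>

lemma to_fract_prod: "to_fract (prod g I) = (\<Prod>i\<in>I. to_fract (g i))"
  by (induction I rule: infinite_finite_induct) auto

lemma A_pairs_no_mixed:
  "(A_pairs s :: 'n::{finite,linorder} mpol fract set)
     = {to_fract p / (\<Prod>j\<in>UNIV. to_fract (at_var j (e j))) | p e. \<forall>j. e j \<in> S_min s}"
  unfolding A_pairs_def loc_def S_pairs_eq to_fract_prod[symmetric] by blast

lemma sum_singles: "(\<Sum>k\<in>Poly_Mapping.keys t. Poly_Mapping.single k (Poly_Mapping.lookup t k)) = t"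
proof (rule poly_mapping_eqI)
  fix k
  have "Poly_Mapping.lookup (\<Sum>k\<in>Poly_Mapping.keys t. Poly_Mapping.single k (Poly_Mapping.lookup t k)) k
      = (\<Sum>l\<in>Poly_Mapping.keys t. if l = k then Poly_Mapping.lookup t k else 0)"
    unfolding lookup_sum lookup_single when_def by (intro sum.cong) auto
  then show "Poly_Mapping.lookup (\<Sum>k\<in>Poly_Mapping.keys t. Poly_Mapping.single k (Poly_Mapping.lookup t k)) k
      = Poly_Mapping.lookup t k"
    by (simp add: in_keys_iff)
qed

definition pure_mult :: "('n \<Rightarrow> complex poly fract) \<Rightarrow> 'n::{finite,linorder} mpol fract" where
  "pure_mult a = (\<Prod>j\<in>UNIV. iota j (a j))"

lemma tensor_mult_add: "tensor_mult (t + u) = tensor_mult t + tensor_mult u"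
  unfolding tensor_mult_def
  by (rule setsum_keys_plus_distrib) (simp_all add: mcst_add distrib_right)

lemma tensor_mult_single: "tensor_mult (Poly_Mapping.single a z) = mcst z * pure_mult a"
  by (cases "z = 0") (simp_all add: tensor_mult_def pure_mult_def)

lemma tensor_mult_zero: "tensor_mult 0 = 0"
  by (simp add: tensor_mult_def)

lemma tensor_mult_diff: "tensor_mult (t - u) = tensor_mult t - tensor_mult u"
  using tensor_mult_add[of "t - u" u] by simp

lemma tensor_mult_sum: "tensor_mult (sum g I) = (\<Sum>i\<in>I. tensor_mult (g i))"
  by (induction I rule: infinite_finite_induct) (simp_all add: tensor_mult_zero tensor_mult_add)

lemma pure_mult_update:
  fixes j :: "'n::{finite,linorder}"
  shows "pure_mult (a(j := u)) = iota j u * (\<Prod>i\<in>UNIV - {j}. iota i (a i))"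
proof -
  have "pure_mult (a(j := u)) = iota j ((a(j := u)) j) * (\<Prod>i\<in>UNIV - {j}. iota i ((a(j := u)) i))"
    unfolding pure_mult_def by (rule prod.remove) simp_all
  also have "(\<Prod>i\<in>UNIV - {j}. iota i ((a(j := u)) i)) = (\<Prod>i\<in>UNIV - {j}. iota i (a i))"
    by (rule prod.cong) auto
  finally show ?thesis
    by (simp only: fun_upd_same)
qed

lemma tensor_mult_tensor_rel:
  fixes t :: "('n::{finite,linorder} \<Rightarrow> complex poly fract) \<Rightarrow>\<^sub>0 complex"
  shows "t \<in> tensor_rel A \<Longrightarrow> tensor_mult t = 0"
proof (induction rule: tensor_rel.induct)
  case zero
  show ?case by (rule tensor_mult_zero)
next
  case (add t a u v j z)
  then show ?case
    by (simp add: tensor_mult_add tensor_mult_diff tensor_mult_single pure_mult_update iota_eq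
        pair.ext_add algebra_simps)
next
  case (scale t a u j w z)
  then show ?case
    by (simp add: tensor_mult_add tensor_mult_diff tensor_mult_single pure_mult_update mcst_mult
        pair.ext_mult[folded iota_eq] iota_cst algebra_simps)
qed

text \<open>The rules append one relation at a time on the right, so the induction runs over the
  second summand.\<close>

lemma tensor_rel_add: "u \<in> tensor_rel A \<Longrightarrow> t \<in> tensor_rel A \<Longrightarrow> t + u \<in> tensor_rel A"
proof (induction rule: tensor_rel.induct)
  case (add u' a u v j z)
  then show ?case
    using tensor_rel.add[of "t + u'" A a u v j z] by (simp add: add.assoc)
next
  case (scale u' a u j w z)
  then show ?case
    using tensor_rel.scale[of "t + u'" A a u j w z] by (simp add: add.assoc)
qed simp

section \<open>Monomial bases and the image of the tensor product map\<close>

definition mono_exp :: "('n::finite \<Rightarrow> nat) \<Rightarrow> 'n \<Rightarrow>\<^sub>0 nat" where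
  "mono_exp k = (\<Sum>j\<in>UNIV. Poly_Mapping.single j (k j))"

lemma lookup_mono_exp: "Poly_Mapping.lookup (mono_exp k) = k"
  by (simp add: fun_eq_iff mono_exp_def lookup_sum lookup_single when_def)

lemma mono_exp_lookup: "mono_exp (Poly_Mapping.lookup m) = m"
  by (rule poly_mapping_eqI) (simp add: lookup_mono_exp)

lemma prod_mvar_power:
  "(\<Prod>j\<in>UNIV. mvar j ^ k j) = (Poly_Mapping.single (mono_exp k) 1 :: 'n::{finite,linorder} mpol)"
proof -
  have "(\<Prod>j\<in>J. mvar j ^ k j)
      = (Poly_Mapping.single (\<Sum>j\<in>J. Poly_Mapping.single j (k j)) 1 :: 'n::{finite,linorder} mpol)" for J
    by (induction J rule: infinite_finite_induct) (simp_all add: mvar_power mult_single)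
  then show ?thesis
    by (simp add: mono_exp_def)
qed

text \<open>For fixed nonzero e these form a C-basis of the fractions with denominator e.\<close>

definition frac_basis :: "complex poly \<Rightarrow> nat \<Rightarrow> complex poly fract" where
  "frac_basis e k = to_fract (monom 1 k) / to_fract e"

lemma iota_frac_basis:
  "e \<noteq> 0 \<Longrightarrow> iota j (frac_basis e k) = to_fract (mvar j ^ k) / to_fract (at_var j e)"
  by (simp add: frac_basis_def iota_eq pair.ext_quot)
    (simp add: at_var_def map_poly_monom poly_monom)

lemma pure_mult_frac_basis:
  fixes k :: "'n::{finite,linorder} \<Rightarrow> nat"
  assumes "\<And>j. e j \<noteq> 0"
  shows "mcst z * pure_mult (\<lambda>j. frac_basis (e j) (k j))
    = to_fract (Poly_Mapping.single (mono_exp k) z) / (\<Prod>j\<in>UNIV. to_fract (at_var j (e j)))"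
proof -
  have "pure_mult (\<lambda>j. frac_basis (e j) (k j))
      = to_fract (\<Prod>j\<in>UNIV. mvar j ^ k j) / (\<Prod>j\<in>UNIV. to_fract (at_var j (e j)))"
    by (simp add: pure_mult_def iota_frac_basis assms prod_dividef to_fract_prod)
  moreover have "mconst z * Poly_Mapping.single (mono_exp k) 1 = Poly_Mapping.single (mono_exp k) z"
    by (simp add: mconst_def mult_single)
  ultimately show ?thesis
    by (simp add: prod_mvar_power mcst_def flip: to_fract_mult)
qed

lemma frac_basis_in: "e \<in> S_min s \<Longrightarrow> frac_basis e k \<in> A_min s"
  unfolding frac_basis_def A_min_def by (rule locI)

text \<open>Surjectivity: once the numerator is expanded into monomials, a fraction whose
  denominator splits by variables is a sum of products of one-variable fractions.\<close>

lemma tensor_mult_image: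
  "tensor_mult ` tensor_free (A_min s) = (A_pairs s :: 'n::{finite,linorder} mpol fract set)"
proof (intro equalityI subsetI)
  fix x :: "'n mpol fract" assume "x \<in> tensor_mult ` tensor_free (A_min s)"
  then show "x \<in> A_pairs s"
    by (auto simp: tensor_mult_def tensor_free_def mcst_in iota_in
        intro!: subring_sum[OF is_subring_A_pairs] subring_mult[OF is_subring_A_pairs]
          subring_prod[OF is_subring_A_pairs])
next
  fix x :: "'n mpol fract" assume "x \<in> A_pairs s"
  then obtain p e where x: "x = to_fract p / (\<Prod>j\<in>UNIV. to_fract (at_var j (e j)))"
    and e: "\<And>j. e j \<in> S_min s"
    unfolding A_pairs_no_mixed by blast
  define t where "t = (\<Sum>m\<in>Poly_Mapping.keys p.
    Poly_Mapping.single (\<lambda>j. frac_basis (e j) (Poly_Mapping.lookup m j)) (Poly_Mapping.lookup p m))"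
  have "Poly_Mapping.keys t \<subseteq> (\<Union>m\<in>Poly_Mapping.keys p. {\<lambda>j. frac_basis (e j) (Poly_Mapping.lookup m j)})"
    unfolding t_def by (rule order.trans[OF keys_sum]) (auto split: if_splits)
  then have "t \<in> tensor_free (A_min s)"
    using frac_basis_in[OF e] by (auto simp: tensor_free_def)
  moreover have "tensor_mult t = (\<Sum>m\<in>Poly_Mapping.keys p.
      to_fract (Poly_Mapping.single m (Poly_Mapping.lookup p m)) / (\<Prod>j\<in>UNIV. to_fract (at_var j (e j))))"
    using S_min_nz[OF e]
    by (simp add: t_def tensor_mult_sum tensor_mult_single pure_mult_frac_basis[of e] mono_exp_lookup)
  then have "tensor_mult t = x"
    by (simp add: x sum_singles flip: sum_divide_distrib to_fract_sum)
  ultimately show "x \<in> tensor_mult ` tensor_free (A_min s)"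
    by blast
qed

section \<open>Normal forms and the kernel of the tensor product map\<close>

lemma common_denominator:
  assumes T: "mult_set T" "0 \<notin> T" and "finite X" "X \<subseteq> loc T"
  shows "\<exists>e\<in>T. \<forall>x\<in>X. \<exists>p. x = to_fract p / to_fract e"
  using assms(3,4)
proof (induction X)
  case empty
  then show ?case
    using mult_set_one[OF T(1)] by blast
next
  case (insert x X)
  then obtain e where e: "e \<in> T" "\<forall>x\<in>X. \<exists>p. x = to_fract p / to_fract e"
    by auto
  obtain q t where x: "x = to_fract q / to_fract t" "t \<in> T"
    using insert.prems by (auto simp: loc_def)
  have nz: "e \<noteq> 0" "t \<noteq> 0"
    using e x T(2) by auto
  have "\<exists>p. y = to_fract p / to_fract (e * t)" if "y \<in> insert x X" for y
  proof (cases "y = x")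
    case True
    with x nz have "y = to_fract (q * e) / to_fract (e * t)"
      by simp
    then show ?thesis ..
  next
    case False
    with that e obtain p where "y = to_fract p / to_fract e"
      by blast
    with nz have "y = to_fract (p * t) / to_fract (e * t)"
      by simp
    then show ?thesis ..
  qed
  then show ?case
    using mult_set_mult[OF T(1) e(1) x(2)] by blast
qed

text \<open>The general element of the tensor power of (1/e) C[B] in the basis
  \<open>frac_basis e\<close>; the keys of w are exponent families. One e serves all factors, so
  that normal forms can be added.\<close>

definition normal_form :: "complex poly \<Rightarrow> (('n \<Rightarrow> nat) \<Rightarrow>\<^sub>0 complex) \<Rightarrow> ('n \<Rightarrow> complex poly fract) \<Rightarrow>\<^sub>0 complex" where
  "normal_form e w = (\<Sum>k\<in>Poly_Mapping.keys w.
     Poly_Mapping.single (\<lambda>j. frac_basis e (k j)) (Poly_Mapping.lookup w k))"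

lemma normal_form_add: "normal_form e (v + w) = normal_form e v + normal_form e w"
  unfolding normal_form_def by (rule setsum_keys_plus_distrib) (simp_all add: single_add)

lemma normal_form_single:
  "normal_form e (Poly_Mapping.single k z) = Poly_Mapping.single (\<lambda>j. frac_basis e (k j)) z"
  by (cases "z = 0") (simp_all add: normal_form_def)

definition reducible :: "complex poly fract set \<Rightarrow> complex poly \<Rightarrow> (('n \<Rightarrow> complex poly fract) \<Rightarrow>\<^sub>0 complex) set" where
  "reducible A e = {t. \<exists>w. t - normal_form e w \<in> tensor_rel A}"

lemma reducible_add: "t \<in> reducible A e \<Longrightarrow> u \<in> reducible A e \<Longrightarrow> t + u \<in> reducible A e"
proof -
  assume "t \<in> reducible A e" "u \<in> reducible A e"
  then obtain v w where "t - normal_form e v \<in> tensor_rel A" "u - normal_form e w \<in> tensor_rel A"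
    by (auto simp: reducible_def)
  then have "(t - normal_form e v) + (u - normal_form e w) \<in> tensor_rel A"
    by (intro tensor_rel_add)
  then have "(t + u) - normal_form e (v + w) \<in> tensor_rel A"
    by (simp add: normal_form_add algebra_simps)
  then show ?thesis
    by (auto simp: reducible_def)
qed

lemma reducible_rel: "t \<in> tensor_rel A \<Longrightarrow> t \<in> reducible A e"
  unfolding reducible_def by (intro CollectI exI[of _ 0]) (simp add: normal_form_def)

lemma reducible_normal_form: "normal_form e w \<in> reducible A e"
  unfolding reducible_def by (intro CollectI exI[of _ w]) (simp add: tensor_rel.zero)

lemma reducible_sum: "(\<And>i. i \<in> I \<Longrightarrow> g i \<in> reducible A e) \<Longrightarrow> sum g I \<in> reducible A e"
  by (induction I rule: infinite_finite_induct)
    (auto intro: reducible_add reducible_rel tensor_rel.zero)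

text \<open>J holds the positions whose entry may not yet be a basis fraction. Each step clears one
  of them by expanding its numerator into monomials with the two kinds of relations; z is
  generalized because scaling moves coefficients into it.\<close>

lemma reducible_single:
  fixes a :: "'n::finite \<Rightarrow> complex poly fract"
  assumes A: "\<And>p. to_fract p / to_fract e \<in> A"
    and "finite J" "\<And>j. \<exists>p. a j = to_fract p / to_fract e" "\<And>j. j \<notin> J \<Longrightarrow> a j \<in> range (frac_basis e)"
  shows "Poly_Mapping.single a z \<in> reducible A e"
  using assms(2-)
proof (induction J arbitrary: a z)
  case empty
  then have "\<forall>j. \<exists>k. a j = frac_basis e k"
    by blast
  then obtain k where "\<And>j. a j = frac_basis e (k j)"
    by metis
  then have "a = (\<lambda>j. frac_basis e (k j))"
    by blast
  then show ?case
    using reducible_normal_form[of e "Poly_Mapping.single k z"] by (simp add: normal_form_single)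
next
  case (insert j J)
  have a_in: "a i \<in> A" for i
    using insert.prems(1)[of i] A by auto
  \<comment> \<open>The numerators that can be handled at position j. They are closed under addition
    and include all monomials, hence are all of C[B].\<close>
  define Y where "Y = {p. \<forall>z. Poly_Mapping.single (a(j := to_fract p / to_fract e)) z \<in> reducible A e}"
  have Y_add: "p + q \<in> Y" if "p \<in> Y" "q \<in> Y" for p q
    unfolding Y_def
  proof (intro CollectI allI)
    fix z
    let ?u = "to_fract p / to_fract e" and ?v = "to_fract q / to_fract e"
    \<comment> \<open>Adding the two single tensors back to this relation telescopes to the tensor
      with the summed entry.\<close>
    have "0 + (Poly_Mapping.single (a(j := ?u + ?v)) z - Poly_Mapping.single (a(j := ?u)) z
        - Poly_Mapping.single (a(j := ?v)) z) \<in> tensor_rel A"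
      by (intro tensor_rel.add tensor_rel.zero a_in A)
    then have "(0 + (Poly_Mapping.single (a(j := ?u + ?v)) z - Poly_Mapping.single (a(j := ?u)) z
        - Poly_Mapping.single (a(j := ?v)) z)) + Poly_Mapping.single (a(j := ?u)) z
        + Poly_Mapping.single (a(j := ?v)) z \<in> reducible A e"
      by (rule reducible_add[OF reducible_add[OF reducible_rel]]) (use that in \<open>auto simp: Y_def\<close>)
    then show "Poly_Mapping.single (a(j := to_fract (p + q) / to_fract e)) z \<in> reducible A e"
      by (simp add: add_divide_distrib)
  qed
  have Y_monom: "monom c k \<in> Y" for c k
    unfolding Y_def
  proof (intro CollectI allI)
    fix z
    have eq: "to_fract (monom c k) / to_fract e = cst c * frac_basis e k"
      by (simp add: frac_basis_def cst_def smult_monom flip: to_fract_mult)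
    have "0 + (Poly_Mapping.single (a(j := cst c * frac_basis e k)) z
        - Poly_Mapping.single (a(j := frac_basis e k)) (c * z)) \<in> tensor_rel A"
      by (intro tensor_rel.scale tensor_rel.zero a_in) (simp add: frac_basis_def A)
    moreover have "Poly_Mapping.single (a(j := frac_basis e k)) (c * z) \<in> reducible A e"
      using insert.prems by (intro insert.IH) (auto simp: frac_basis_def)
    ultimately have "(0 + (Poly_Mapping.single (a(j := cst c * frac_basis e k)) z
        - Poly_Mapping.single (a(j := frac_basis e k)) (c * z)))
        + Poly_Mapping.single (a(j := frac_basis e k)) (c * z) \<in> reducible A e"
      by (rule reducible_add[OF reducible_rel])
    then show "Poly_Mapping.single (a(j := to_fract (monom c k) / to_fract e)) z \<in> reducible A e"
      by (simp add: eq)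
  qed
  have Y_sum: "sum g I \<in> Y" if "\<And>i. i \<in> I \<Longrightarrow> g i \<in> Y" for g and I :: "nat set"
    using that Y_monom[of 0 0] by (induction I rule: infinite_finite_induct) (auto intro: Y_add)
  obtain p where p: "a j = to_fract p / to_fract e"
    using insert.prems(1) by blast
  have "(\<Sum>i\<le>degree p. monom (coeff p i) i) \<in> Y"
    by (intro Y_sum Y_monom)
  then have "p \<in> Y"
    by (simp only: poly_as_sum_of_monoms)
  then have "Poly_Mapping.single (a(j := to_fract p / to_fract e)) z \<in> reducible A e"
    by (simp add: Y_def)
  then show ?case
    by (simp only: p[symmetric] fun_upd_triv)
qed

text \<open>Over the common denominator, the numerator has coefficient \<open>lookup w k\<close> at
  the monomial \<open>mono_exp k\<close>, and distinct k give distinct monomials.\<close>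

lemma normal_form_kernel:
  fixes w :: "('n::{finite,linorder} \<Rightarrow> nat) \<Rightarrow>\<^sub>0 complex"
  assumes e: "e \<noteq> 0" and "tensor_mult (normal_form e w) = 0"
  shows "w = 0"
proof -
  let ?D = "\<Prod>j\<in>UNIV. to_fract (at_var j e) :: 'n mpol fract"
  let ?P = "\<Sum>k\<in>Poly_Mapping.keys w. Poly_Mapping.single (mono_exp k) (Poly_Mapping.lookup w k) :: 'n mpol"
  have "tensor_mult (normal_form e w) = to_fract ?P / ?D"
    by (simp add: normal_form_def tensor_mult_sum tensor_mult_single pure_mult_frac_basis[of "\<lambda>_. e", OF e]
        sum_divide_distrib)
  moreover have "?D \<noteq> 0"
    using e by (simp add: pair.f_eq_0_iff)
  ultimately have "to_fract ?P = 0"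
    using assms(2) by simp
  then have P: "?P = 0"
    unfolding to_fract_eq_0_iff .
  show ?thesis
  proof (rule poly_mapping_eqI)
    fix k
    have inj: "mono_exp l = mono_exp k \<longleftrightarrow> l = k" for l :: "'n \<Rightarrow> nat"
      by (metis lookup_mono_exp)
    have "Poly_Mapping.lookup ?P (mono_exp k)
        = (\<Sum>l\<in>Poly_Mapping.keys w. if l = k then Poly_Mapping.lookup w k else 0)"
      unfolding lookup_sum lookup_single when_def inj by (intro sum.cong) auto
    then show "Poly_Mapping.lookup w k = Poly_Mapping.lookup 0 k"
      unfolding P by (simp add: in_keys_iff split: if_splits)
  qed
qed

text \<open>Since \<open>tensor_mult\<close> kills relations, the normal form of a tensor in the
  kernel also maps to 0 and is therefore trivial, which leaves the tensor itself as a
  relation.\<close>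

lemma tensor_mult_kernel:
  fixes t :: "('n::{finite,linorder} \<Rightarrow> complex poly fract) \<Rightarrow>\<^sub>0 complex"
  assumes t: "t \<in> tensor_free (A_min s)"
  shows "tensor_mult t = 0 \<longleftrightarrow> t \<in> tensor_rel (A_min s)"
proof
  assume zero: "tensor_mult t = 0"
  have "finite (\<Union>a\<in>Poly_Mapping.keys t. range a)" "(\<Union>a\<in>Poly_Mapping.keys t. range a) \<subseteq> loc (S_min s)"
    using t by (auto simp: tensor_free_def A_min_def)
  from common_denominator[OF mult_set_S_min zero_notin_S_min this]
  obtain e where e: "e \<in> S_min s"
    "\<And>a j. a \<in> Poly_Mapping.keys t \<Longrightarrow> \<exists>p. a j = to_fract p / to_fract e"
    by blast
  \<comment> \<open>With \<open>J = UNIV\<close> no entry has to be a basis fraction at the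
    start.\<close>
  have "(\<Sum>a\<in>Poly_Mapping.keys t. Poly_Mapping.single a (Poly_Mapping.lookup t a)) \<in> reducible (A_min s) e"
    using e by (intro reducible_sum reducible_single[where J = UNIV]) (auto simp: A_min_def intro: locI)
  then obtain w where w: "t - normal_form e w \<in> tensor_rel (A_min s)"
    by (auto simp: sum_singles reducible_def)
  then have "tensor_mult (normal_form e w) = 0"
    using tensor_mult_tensor_rel[OF w] zero by (simp add: tensor_mult_diff)
  then have "w = 0"
    by (rule normal_form_kernel[OF S_min_nz[OF e(1)]])
  with w show "t \<in> tensor_rel (A_min s)"
    by (simp add: normal_form_def)
qed (rule tensor_mult_tensor_rel)

theorem theorem3p3:
  fixes s q :: complex and m :: nat
    and deg_plus deg_minus :: "'v \<Rightarrow> nat"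
    and nn_plus nn_minus :: "'v \<Rightarrow> 'v \<Rightarrow>\<^sub>0 complex"
    and nns_plus nns_minus :: "'n::{finite,linorder} \<Rightarrow> 'v \<Rightarrow> 'v \<Rightarrow>\<^sub>0 complex"
  assumes "q \<noteq> 1"
  shows
    "\<comment> \<open>one pair: sufficiency\<close>
     (\<forall>c. entries_in (A_min s) (Q_plus s c) \<and> entries_in (A_min s) (Q_minus s c)
        \<and> contracting slot_odd (A_min s) (Q_plus s c) (h_plus s c)
        \<and> contracting slot_odd (A_min s) (Q_minus s c) (h_minus s c)
        \<and> (\<forall>r. entries_in (A_min s) (N_plus s q m r c) \<and> entries_in (A_min s) (N_minus s q m r c))
        \<and> gauge_over cst (A_min s) deg_plus (\<lambda>_::unit. nn_plus) (\<lambda>_ r. N_plus s q m r c)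
        \<and> gauge_over cst (A_min s) deg_minus (\<lambda>_::unit. nn_minus) (\<lambda>_ r. N_minus s q m r c))
     \<and> \<comment> \<open>one pair: minimality\<close>
     (\<forall>T. mult_set T \<and> (\<forall>p\<in>T. shift 1 p \<in> T)
        \<and> (\<forall>c. contractible_over slot_odd (loc T) (Q_plus s c)
             \<and> contractible_over slot_odd (loc T) (Q_minus s c))
        \<longrightarrow> S_min s \<subseteq> saturation T)
     \<and> \<comment> \<open>several pairs: sufficiency\<close>
     (\<forall>c::'n \<Rightarrow> int.
          entries_in (A_pairs s) (Q_pairs (Q_plus s) c) \<and> entries_in (A_pairs s) (Q_pairs (Q_minus s) c)
        \<and> contracting tensor_odd (A_pairs s) (Q_pairs (Q_plus s) c) (h_pairs (h_plus s) c)
        \<and> contracting tensor_odd (A_pairs s) (Q_pairs (Q_minus s) c) (h_pairs (h_minus s) c)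
        \<and> gauge_over mcst (A_pairs s) deg_plus nns_plus (\<lambda>i r. hat i (N_plus s q m r (c i)))
        \<and> gauge_over mcst (A_pairs s) deg_minus nns_minus (\<lambda>i r. hat i (N_minus s q m r (c i))))
     \<and> \<comment> \<open>several pairs: minimality for the four-slot complexes of all pairs\<close>
     (\<forall>T :: 'n mpol set. mult_set T \<and> (\<forall>j. \<forall>p\<in>T. mshift j p \<in> T)
        \<and> (\<forall>j c. contractible_over slot_odd (loc T) (iota_map j (Q_plus s c))
               \<and> contractible_over slot_odd (loc T) (iota_map j (Q_minus s c)))
        \<longrightarrow> S_pairs s \<subseteq> saturation T)
     \<and> \<comment> \<open>several pairs: minimality for the canonical differentials and homotopies\<close>
     (\<forall>T :: 'n mpol set. mult_set T \<and> (\<forall>j. \<forall>p\<in>T. mshift j p \<in> T)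
        \<and> (\<forall>c. entries_in (loc T) (Q_pairs (Q_plus s) c) \<and> entries_in (loc T) (h_pairs (h_plus s) c)
             \<and> entries_in (loc T) (Q_pairs (Q_minus s) c) \<and> entries_in (loc T) (h_pairs (h_minus s) c))
        \<longrightarrow> S_pairs s \<subseteq> saturation T)
     \<and> \<comment> \<open>tensor product of the one-pair localizations\<close>
     tensor_mult ` tensor_free (A_min s) = (A_pairs s :: 'n mpol fract set)
     \<and> (\<forall>t\<in>tensor_free (A_min s). (tensor_mult t :: 'n mpol fract) = 0 \<longleftrightarrow> t \<in> tensor_rel (A_min s))
     \<and> \<comment> \<open>no mixed denominators\<close>
     (A_pairs s :: 'n mpol fract set)
       = {to_fract p / (\<Prod>j\<in>UNIV. to_fract (at_var j (e j))) | p e. \<forall>j. e j \<in> S_min s}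
     \<and> \<comment> \<open>coalescence of the orbit families\<close>
     (orbit_family d_pol = orbit_family (l_plus s) \<longleftrightarrow> (\<exists>k::int. s = of_int (4 * k + 2)))
     \<and> (orbit_family d_pol = orbit_family (l_minus s) \<longleftrightarrow> (\<exists>k::int. s = of_int (4 * k + 2)))
     \<and> (orbit_family (l_plus s) = orbit_family (l_minus s) \<longleftrightarrow> (\<exists>k::int. s = of_int (2 * k)))"
  by (intro conjI allI impI ballI; (elim conjE)?;
      (rule Q_entries contracting_one_pair N_entries gauge_one_pair Q_pairs_entries[OF Q_entries(1)]
        Q_pairs_entries[OF Q_entries(2)] contracting_pairs gauge_pairs tensor_mult_image
        A_pairs_no_mixed coalescence_d_plus coalescence_d_minus coalescence_plus_minus
       | erule tensor_mult_kernel
       | (rule minimal_one_pair minimal_pairs_contractible minimal_pairs_homotopies; blast)))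

end
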